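(* There exist infinitely many pairs $\{D, D'\}$ of RI-III related trivial knot diagrams such that $D$ and $D'$ cannot be transformed into each other by applying a sequence of $\Omega_1^{\uparrow}$ moves, followed by a sequence of $\Omega_3$ moves, followed by a sequence of $\Omega_1^{\downarrow}$ moves.
   Context: Link diagrams are considered on $\mathbb{S}^2$, up to isotopy of the sphere; a trivial knot diagram is a diagram representing the trivial knot. A Reidemeister move I ($\Omega_1$) is the local move that, inside a disk, exchanges a single crossingless arc and an arc with exactly one self-crossing bounding a monogon (a kink, of either crossing type and on either side). It is denoted $\Omega_1^{\uparrow}$ when it creates the crossing (increases the number of crossings by one) and $\Omega_1^{\downarrow}$ when it removes the crossing. A Reidemeister move III ($\Omega_3$) is the usual local move inside a disk containing three arcs (a top, a middle and a bottom one) crossing pairwise once and bounding a triangle, which passes one arc across the crossing of the other two. Two link diagrams are RI-III related if they are transformed into each other by applying finitely many Reidemeister moves I and III. Every sequence of moves is finite and may be empty. *)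

theory Defs
  imports Main "HOL-Combinatorics.Orbits"
begin

text \<open>
  A one-component diagram on the sphere is a connected 4-valent map on the sphere with over/under
  information, and up to isotopy of the sphere it is determined by its signed Gauss code: travel
  once along the knot and record, for every passage through a crossing, the crossing, whether one
  is on the upper strand, and the sign of the crossing.  The sign does not depend on the direction
  of travel.  The crossingless circle has the empty code.
\<close>

datatype passage = Passage (crossing: nat) (over: bool) (positive: bool)

type_synonym gauss_code = "passage list"

definition well_formed :: "gauss_code \<Rightarrow> bool" where
  "well_formed w \<longleftrightarrow> distinct w \<and>
     (\<forall>c o' s. Passage c o' s \<in> set w \<longrightarrow>
        Passage c (\<not> o') s \<in> set w \<and> Passage c o' (\<not> s) \<notin> set w)"

text \<open>
  The 4-valent map of a code.  Edge \<open>i\<close> runs from passage \<open>i\<close> to passage \<open>i + 1\<close> (indices modulo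
  the length).  The dart \<open>(i, True)\<close> is the half-edge leaving passage \<open>i\<close>, and \<open>(i, False)\<close> is the
  half-edge entering it; a dart also stands for its edge directed away from that passage.
\<close>

type_synonym dart = "nat \<times> bool"

definition darts :: "gauss_code \<Rightarrow> dart set" where
  "darts w = {..<length w} \<times> UNIV"

definition mate :: "gauss_code \<Rightarrow> nat \<Rightarrow> nat" where
  "mate w i = (THE j. j < length w \<and> j \<noteq> i \<and> crossing (w ! j) = crossing (w ! i))"

fun edge_of :: "gauss_code \<Rightarrow> dart \<Rightarrow> nat" where
  "edge_of w (i, True) = i"
| "edge_of w (i, False) = (i + length w - 1) mod length w"

fun flip :: "gauss_code \<Rightarrow> dart \<Rightarrow> dart" where
  "flip w (i, True) = ((i + 1) mod length w, False)"
| "flip w (i, False) = ((i + length w - 1) mod length w, True)"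

text \<open>
  The next dart counterclockwise around the crossing.  Seen from passage \<open>i\<close>, the other strand
  passes from right to left iff \<open>i\<close> is the upper strand of a positive crossing or the lower strand
  of a negative one.
\<close>

fun rot :: "gauss_code \<Rightarrow> dart \<Rightarrow> dart" where
  "rot w (i, out) =
     (mate w i, if over (w ! i) = positive (w ! i) then out else \<not> out)"

text \<open>The faces are traced keeping the face on the right-hand side.\<close>

definition face_next :: "gauss_code \<Rightarrow> dart \<Rightarrow> dart" where
  "face_next w d = rot w (flip w d)"

definition faces :: "gauss_code \<Rightarrow> dart set set" where
  "faces w = orbit (face_next w) ` darts w"

text \<open>
  With \<open>n\<close> crossings the map has \<open>2 n\<close> edges and is connected, so it lies on the sphere iff
  \<open>n - 2 n + card (faces w) = 2\<close>.  The crossingless circle has no darts, so its two faces do not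
  appear as orbits and it needs a separate clause.
\<close>

definition spherical :: "gauss_code \<Rightarrow> bool" where
  "spherical w \<longleftrightarrow> w = [] \<or> card (faces w) = length w div 2 + 2"

definition knot_code :: "gauss_code \<Rightarrow> bool" where
  "knot_code w \<longleftrightarrow> well_formed w \<and> spherical w"

text \<open>
  Two codes describe the same diagram up to isotopy of the sphere iff they differ by the names of
  the crossings, the starting point and the direction of travel.  Reflections of the sphere are not
  isotopies; they would reverse all signs.
\<close>

fun rename :: "(nat \<Rightarrow> nat) \<Rightarrow> passage \<Rightarrow> passage" where
  "rename f (Passage c o' s) = Passage (f c) o' s"

definition isotopic :: "gauss_code \<Rightarrow> gauss_code \<Rightarrow> bool" where
  "isotopic w w' \<longleftrightarrow> knot_code w \<and> knot_code w' \<and>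
     (\<exists>f k. inj_on f (crossing ` set w) \<and>
        (w' = map (rename f) (rotate k w) \<or> w' = map (rename f) (rotate k (rev w))))"

lemma rename_sel [simp]:
  "crossing (rename f x) = f (crossing x)"
  "over (rename f x) = over x"
  "positive (rename f x) = positive x"
  by (cases x; simp)+

lemma knot_code_Nil: "knot_code []"
  by (simp add: knot_code_def well_formed_def spherical_def)


lemma rename_inverse:
  assumes "\<And>c. c \<in> crossing ` set w \<Longrightarrow> g (f c) = c"
  shows "map (rename g) (map (rename f) w) = w"
proof -
  have "rename g (rename f x) = x" if "x \<in> set w" for x
  proof -
    have "g (f (crossing x)) = crossing x" using that assms by blast
    then show ?thesis by (simp add: passage.expand)
  qed
  then show ?thesis by (simp add: map_idI)
qed

lemma rename_comp: "rename g (rename f x) = rename (g \<circ> f) x"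
  by (cases x) simp

lemma rotate_inverse: "\<exists>j. w = rotate j (rotate k w)"
proof (cases "w = []")
  case False
  then have "(length w - k mod length w + k) mod length w = 0"
    by (metis add.commute le_add_diff_inverse2 length_greater_0_conv mod_add_left_eq mod_le_divisor
        mod_self)
  then show ?thesis
    by (intro exI[of _ "length w - k mod length w"]) (simp add: rotate_rotate rotate_id)
qed simp

lemma rotate_rev_inverse: "\<exists>j. w = rotate j (rev (rotate k (rev w)))"
proof -
  have "rev (rotate k (rev w)) = rotate (length w - k mod length w) w"
    by (simp add: rotate_rev)
  then show ?thesis using rotate_inverse by metis
qed

lemma isotopic_refl: "isotopic w w" if "knot_code w"
proof -
  have "rename id x = x" for x by (cases x) simp
  then show ?thesis
    using that unfolding isotopic_def by (intro conjI exI[of _ id] exI[of _ 0]) (auto simp: map_idI)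
qed

lemma isotopic_sym:
  assumes "isotopic w w'"
  shows "isotopic w' w"
proof -
  obtain f k where f: "inj_on f (crossing ` set w)"
    and w': "w' = map (rename f) (rotate k w) \<or> w' = map (rename f) (rotate k (rev w))"
    using assms unfolding isotopic_def by blast
  define g where "g = the_inv_into (crossing ` set w) f"
  have gf: "g (f c) = c" if "c \<in> crossing ` set w" for c
    using f that by (simp add: g_def the_inv_into_f_f)
  have set: "crossing ` set w' = f ` crossing ` set w"
    using w' by (auto simp: image_image)
  have g: "inj_on g (crossing ` set w')"
    unfolding set by (rule inj_onI) (auto simp: gf)
  have "map (rename g) w' = rotate k w \<or> map (rename g) w' = rotate k (rev w)"
    using w' rename_inverse[of "rotate k w" g f] rename_inverse[of "rotate k (rev w)" g f] gf by auto
  then have "\<exists>j. w = rotate j (map (rename g) w') \<or> w = rotate j (rev (map (rename g) w'))"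
    using rotate_inverse[of w k] rotate_rev_inverse[of w k] by metis
  then have "\<exists>j. w = map (rename g) (rotate j w') \<or> w = map (rename g) (rotate j (rev w'))"
    by (simp add: rotate_map rev_map)
  then show ?thesis using assms g unfolding isotopic_def by blast
qed

lemma isotopic_trans:
  assumes "isotopic w w'" "isotopic w' w''"
  shows "isotopic w w''"
proof -
  obtain f k where f: "inj_on f (crossing ` set w)"
    and w': "w' = map (rename f) (rotate k w) \<or> w' = map (rename f) (rotate k (rev w))"
    using assms(1) unfolding isotopic_def by blast
  obtain g l where g: "inj_on g (crossing ` set w')"
    and w'': "w'' = map (rename g) (rotate l w') \<or> w'' = map (rename g) (rotate l (rev w'))"
    using assms(2) unfolding isotopic_def by blast
  have set: "crossing ` set w' = f ` crossing ` set w"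
    using w' by (auto simp: image_image)
  have gf: "inj_on (g \<circ> f) (crossing ` set w)"
    using f g unfolding set by (rule comp_inj_on)
  have "\<exists>j. rotate l (rev (rotate k w)) = rotate j (rev w)"
    by (metis rev_rev_ident rotate_rev rotate_rotate)
  moreover have "\<exists>j. rotate l (rev (rotate k (rev w))) = rotate j w"
    by (metis rev_rev_ident rotate_rev rotate_rotate length_rev)
  ultimately have "\<exists>j. w'' = map (rename (g \<circ> f)) (rotate j w)
      \<or> w'' = map (rename (g \<circ> f)) (rotate j (rev w))"
    using w' w'' by (elim disjE) (auto simp: rotate_map rev_map rotate_rotate rename_comp comp_def)
  then show ?thesis using assms gf unfolding isotopic_def by blast
qed

quotient_type knot_diagram = gauss_code / partial: isotopic
proof (rule part_equivpI)
  show "\<exists>w. isotopic w w" using isotopic_refl knot_code_Nil by blast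
  show "symp isotopic" by (rule sympI) (rule isotopic_sym)
  show "transp isotopic" by (rule transpI) (rule isotopic_trans)
qed

definition represents :: "gauss_code \<Rightarrow> knot_diagram \<Rightarrow> bool" where
  "represents w D \<longleftrightarrow> knot_code w \<and> abs_knot_diagram w = D"

definition unknot_diagram :: knot_diagram where
  "unknot_diagram = abs_knot_diagram []"

text \<open>
  Crossings are unordered labels and codes are cyclic, so a move is a relation between some codes of
  the two diagrams.  In the moves below, a suitable starting point lets the arcs in the disk be factors of the code
  which do not wrap around.

  First move, creating a crossing: the values of \<open>o'\<close> and \<open>s\<close> give the four kinks (which strand is
  on top, and on which side the monogon lies).  Two consecutive passages through the same crossing
  always bound a monogon.
\<close>

definition omega1_up :: "knot_diagram \<Rightarrow> knot_diagram \<Rightarrow> bool" where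
  "omega1_up D D' \<longleftrightarrow>
     (\<exists>u v c o' s. represents (u @ v) D \<and>
        represents (u @ [Passage c o' s, Passage c (\<not> o') s] @ v) D')"

abbreviation omega1_down :: "knot_diagram \<Rightarrow> knot_diagram \<Rightarrow> bool" where
  "omega1_down \<equiv> omega1_up\<inverse>\<inverse>"

text \<open>
  Second move, creating two crossings: one strand passes twice in a row over the other, with
  opposite signs.  This makes the two arcs bound a bigon, whichever way the second strand runs; that
  the two arcs could be brought together in the original diagram is expressed by sphericity of the
  new code.
\<close>

definition omega2_up :: "knot_diagram \<Rightarrow> knot_diagram \<Rightarrow> bool" where
  "omega2_up D D' \<longleftrightarrow>
     (\<exists>u v x a b o' s m. represents (u @ v @ x) D \<and>
        m \<in> {[Passage a (\<not> o') s, Passage b (\<not> o') (\<not> s)],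
              [Passage b (\<not> o') (\<not> s), Passage a (\<not> o') s]} \<and>
        represents (u @ [Passage a o' s, Passage b o' (\<not> s)] @ v @ m @ x) D')"

text \<open>
  Third move: the edges from \<open>a\<close> to \<open>a'\<close>, from \<open>b\<close> to \<open>b'\<close> and from \<open>c\<close> to \<open>c'\<close> bound a triangular
  face with three distinct crossings; one of the three arcs is on top at both of its crossings and
  one is at the bottom at both.  After the move each arc meets the other two in the opposite order,
  and the signs are unchanged.
\<close>

definition bounds_triangle :: "gauss_code \<Rightarrow> nat set \<Rightarrow> bool" where
  "bounds_triangle w E \<longleftrightarrow> card E = 3 \<and> (\<exists>F \<in> faces w. card F = 3 \<and> edge_of w ` F = E)"

definition omega3 :: "knot_diagram \<Rightarrow> knot_diagram \<Rightarrow> bool" where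
  "omega3 D D' \<longleftrightarrow>
     (\<exists>p q r t a a' b b' c c'.
        let w = p @ [a, a'] @ q @ [b, b'] @ r @ [c, c'] @ t;
            w' = p @ [a', a] @ q @ [b', b] @ r @ [c', c] @ t;
            i = length p; j = i + 2 + length q; k = j + 2 + length r
        in represents w D \<and> represents w' D' \<and>
           bounds_triangle w {i, j, k} \<and>
           card (crossing ` {a, a', b, b', c, c'}) = 3 \<and>
           (\<exists>(x, y) \<in> {(a, a'), (b, b'), (c, c')}. over x \<and> over y) \<and>
           (\<exists>(x, y) \<in> {(a, a'), (b, b'), (c, c')}. \<not> over x \<and> \<not> over y))"

definition RI_III_related :: "knot_diagram \<Rightarrow> knot_diagram \<Rightarrow> bool" where
  "RI_III_related = (sup omega1_up (sup omega1_down omega3))\<^sup>*\<^sup>*"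

definition same_knot :: "knot_diagram \<Rightarrow> knot_diagram \<Rightarrow> bool" where
  "same_knot = (sup (sup omega1_up omega1_down) (sup (sup omega2_up omega2_up\<inverse>\<inverse>) omega3))\<^sup>*\<^sup>*"

text \<open>Knot types are taken as classes of diagrams under Reidemeister moves (Reidemeister's theorem).\<close>

definition trivial_knot_diagram :: "knot_diagram \<Rightarrow> bool" where
  "trivial_knot_diagram D \<longleftrightarrow> same_knot D unknot_diagram"

definition sorted_transformable :: "knot_diagram \<Rightarrow> knot_diagram \<Rightarrow> bool" where
  "sorted_transformable = omega1_up\<^sup>*\<^sup>* OO omega3\<^sup>*\<^sup>* OO omega1_down\<^sup>*\<^sup>*"

end

theory Submission
  imports Defs
begin

text \<open>
  A standard trefoil projection is turned by one third move into three nested kinks, so with suitable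
  over/under information it is RI-III related to the crossingless circle.  Put a kink on each of its
  six edges.  Now any diagram obtained by creating kinks and by third moves consists of the three
  trefoil crossings with a non-empty tangle on every edge between them: since two of these crossings
  are never adjacent along the knot, the three pairs of passages exchanged by a third move always lie
  inside one of the tangles.  Such a diagram has interlaced crossings, whereas creating kinks
  on the circle never produces any.  Further kinks give infinitely many examples.
\<close>

section \<open>Cyclic adjacency\<close>

text \<open>A sorted sequence joins, by third moves alone, a code grown from the kinked trefoil and
  a code grown from the circle, once the final removals are read backwards.

  The invariant is a coarse word: core passages stay letters, any other passage becomes the name of
  its core edge. A kink inserts two copies of a neighbouring edge name, a third move exchanges equal
  letters. The obstacle is a third move touching the core. Adjacency alone does not exclude it; the
  six passages involved make up three complete crossings, so the partner of each is again among
  them, and this closes up into a contradiction.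

  Existence is the other half of the work: a code is a diagram only if its faces satisfy Euler's
  formula, hence the face tracing through an inserted kink.\<close>

definition cyclic_pairs :: "'a list \<Rightarrow> ('a \<times> 'a) set" where
  "cyclic_pairs xs = set (zip xs (rotate1 xs))"

lemma cyclic_pairs_rotate [simp]: "cyclic_pairs (rotate k xs) = cyclic_pairs xs"
proof -
  have *: "zip (rotate1 a) (rotate1 b) = rotate1 (zip a b)" if "length a = length b"
    for a b :: "'a list"
    using that by (cases a; cases b) auto
  have "cyclic_pairs (rotate1 ys) = cyclic_pairs ys" for ys :: "'a list"
    by (simp add: cyclic_pairs_def *)
  then show ?thesis by (induction k) simp_all
qed

lemma cyclic_pairs_append_commute: "cyclic_pairs (xs @ ys) = cyclic_pairs (ys @ xs)"
  by (metis cyclic_pairs_rotate rotate_append)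

lemma cyclic_pairs_conv:
  assumes "xs \<noteq> []"
  shows "cyclic_pairs xs = insert (last xs, hd xs) (set (zip (butlast xs) (tl xs)))"
proof -
  have "zip xs (rotate1 xs) = zip (butlast xs @ [last xs]) (tl xs @ [hd xs])"
    using assms by (simp add: rotate1_hd_tl)
  also have "\<dots> = zip (butlast xs) (tl xs) @ [(last xs, hd xs)]"
    by (subst zip_append) simp_all
  finally show ?thesis by (simp add: cyclic_pairs_def)
qed

lemma cyclic_pairs_rev: "cyclic_pairs (rev xs) = (cyclic_pairs xs)\<inverse>"
proof (cases "xs = []")
  case False
  have "set (zip (tl xs) (butlast xs)) = (set (zip (butlast xs) (tl xs)))\<inverse>"
    by (subst zip_commute) force
  moreover have "butlast (rev xs) = rev (tl xs)" "tl (rev xs) = rev (butlast xs)"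
    using False by (metis butlast_rev) (metis butlast_rev rev_rev_ident)
  ultimately show ?thesis
    using False by (auto simp: cyclic_pairs_conv hd_rev last_rev zip_rev)
qed (simp add: cyclic_pairs_def)

lemma cyclic_pairs_map: "cyclic_pairs (map f xs) = map_prod f f ` cyclic_pairs xs"
  by (simp add: cyclic_pairs_def rotate1_map zip_map_map map_prod_def)

lemma cyclic_pairs_snoc2:
  assumes "xs \<noteq> []"
  shows "cyclic_pairs (xs @ [a, b]) \<subseteq> cyclic_pairs xs \<union> {(last xs, a), (a, b), (b, hd xs)}"
proof -
  have *: "butlast (xs @ [a, b]) = (butlast xs @ [last xs]) @ [a]" "tl (xs @ [a, b]) = tl xs @ [a, b]"
    using assms by (simp_all add: butlast_append)
  have "zip ((butlast xs @ [last xs]) @ [a]) (tl xs @ [a, b])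
    = zip (butlast xs) (tl xs) @ [(last xs, a), (a, b)]"
    using zip_append[of "butlast xs" "tl xs" "[last xs, a]" "[a, b]"] by simp
  with * assms show ?thesis by (auto simp: cyclic_pairs_conv)
qed

definition adjacent :: "'a list \<Rightarrow> 'a \<Rightarrow> 'a \<Rightarrow> bool" where
  "adjacent xs x y \<longleftrightarrow> (x, y) \<in> cyclic_pairs xs \<or> (y, x) \<in> cyclic_pairs xs"

lemma adjacent_sym: "adjacent xs x y \<Longrightarrow> adjacent xs y x"
  by (auto simp: adjacent_def)

lemma adjacent_append_commute: "adjacent (xs @ ys) = adjacent (ys @ xs)"
  by (intro ext) (simp add: adjacent_def cyclic_pairs_append_commute[of xs])

lemma adjacent_rotate [simp]: "adjacent (rotate k xs) = adjacent xs"
  by (intro ext) (simp add: adjacent_def)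

lemma adjacent_rev [simp]: "adjacent (rev xs) = adjacent xs"
  by (intro ext) (auto simp: adjacent_def cyclic_pairs_rev)

lemma adjacent_map:
  "adjacent (map f xs) x' y' \<longleftrightarrow> (\<exists>x y. x' = f x \<and> y' = f y \<and> adjacent xs x y)"
  unfolding adjacent_def cyclic_pairs_map by auto

lemma adjacent_memD: "adjacent xs x y \<Longrightarrow> x \<in> set xs \<and> y \<in> set xs"
  unfolding adjacent_def cyclic_pairs_def by (auto dest: set_zip_leftD set_zip_rightD)

lemma adjacent_infix: "adjacent (xs @ [x, y] @ ys) x y"
proof -
  have "adjacent ([x, y] @ ys @ xs) x y"
    by (simp add: adjacent_def cyclic_pairs_def)
  then show ?thesis using adjacent_append_commute[of xs "[x, y] @ ys"] by simp
qed

text \<open>\<open>x\<close> and \<open>y\<close> are the cyclic neighbours of the gap between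
  \<open>xs\<close> and \<open>ys\<close>. Inserting \<open>t\<close> twice creates the pairs (x,
  t), (t, t), (t, y), each of which is (t, t) or the old (x, y). Both choices of \<open>t\<close>
  are offered because a kink must copy whichever neighbour is an edge name.\<close>

lemma adjacent_duplicate_neighbour:
  assumes "xs @ ys \<noteq> []"
  obtains x y where "adjacent (xs @ ys) x y"
    "\<And>t p q. t \<in> {x, y} \<Longrightarrow> adjacent (xs @ [t, t] @ ys) p q \<Longrightarrow> adjacent (xs @ ys) p q \<or> p = t \<and> q = t"
proof
  let ?l = "ys @ xs"
  let ?x = "last ?l" and ?y = "hd ?l"
  have l: "?l \<noteq> []" using assms by auto
  have xy: "(?x, ?y) \<in> cyclic_pairs ?l" using cyclic_pairs_conv[OF l] by simp
  then show "adjacent (xs @ ys) ?x ?y" by (simp add: adjacent_append_commute[of xs] adjacent_def)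
  fix t p q assume t: "t \<in> {?x, ?y}" and "adjacent (xs @ [t, t] @ ys) p q"
  then have "adjacent (?l @ [t, t]) p q"
    using adjacent_append_commute[of "xs @ [t, t]" ys] by simp
  then have "adjacent ?l p q \<or> p = t \<and> q = t"
    using cyclic_pairs_snoc2[OF l, of t t] t xy unfolding adjacent_def by auto
  then show "adjacent (xs @ ys) p q \<or> p = t \<and> q = t"
    by (simp add: adjacent_append_commute[of xs])
qed

section \<open>Interlaced crossings\<close>

definition interlaced :: "gauss_code \<Rightarrow> nat \<Rightarrow> nat \<Rightarrow> bool" where
  "interlaced w x y \<longleftrightarrow> x \<noteq> y \<and>
     filter (\<lambda>c. c \<in> {x, y}) (map crossing w) \<in> {[x, y, x, y], [y, x, y, x]}"

lemma interlaced_rev [simp]: "interlaced (rev w) x y \<longleftrightarrow> interlaced w x y"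
  unfolding interlaced_def rev_map[symmetric] rev_filter[symmetric] by (auto simp: rev_swap)

lemma interlaced_rotate [simp]: "interlaced (rotate k w) x y \<longleftrightarrow> interlaced w x y"
proof -
  have *: "interlaced (rotate1 w) x y" if "interlaced w x y" for w
    using that by (cases w) (auto simp: interlaced_def split: if_splits)
  have r: "interlaced (rotate k w) x y" if "interlaced w x y" for k w
    using that * by (induction k) auto
  show ?thesis using r rotate_inverse[of w k] by metis
qed

lemma interlaced_memD:
  assumes "interlaced w x y"
  shows "x \<in> crossing ` set w" "y \<in> crossing ` set w"
proof -
  have "{x, y} \<subseteq> set (filter (\<lambda>c. c \<in> {x, y}) (map crossing w))"
    using assms unfolding interlaced_def by (elim conjE insertE emptyE) (simp_all only: list.set, simp_all)
  also have "\<dots> \<subseteq> set (map crossing w)" by (rule filter_is_subset)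
  finally show "x \<in> crossing ` set w" "y \<in> crossing ` set w" by simp_all
qed

lemma interlaced_rename:
  assumes f: "inj_on f (crossing ` set w)" and "interlaced w x y"
  shows "interlaced (map (rename f) w) (f x) (f y)"
proof -
  have mem: "x \<in> crossing ` set w" "y \<in> crossing ` set w"
    using interlaced_memD assms(2) by auto
  have cr: "crossing \<circ> rename f = f \<circ> crossing" by auto
  have "filter (\<lambda>c. c \<in> {f x, f y}) (map f (map crossing w))
      = map f (filter (\<lambda>c. f c \<in> {f x, f y}) (map crossing w))"
    by (simp add: filter_map comp_def)
  also have "filter (\<lambda>c. f c \<in> {f x, f y}) (map crossing w) = filter (\<lambda>c. c \<in> {x, y}) (map crossing w)"
    using f mem by (intro filter_cong refl) (auto simp: inj_on_eq_iff)
  finally show ?thesis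
    using assms(2) inj_onD[OF f _ mem] by (auto simp: interlaced_def cr)
qed

lemma interlaced_isotopic:
  assumes "isotopic w w'" "interlaced w x y"
  shows "\<exists>x y. interlaced w' x y"
proof -
  obtain f k where f: "inj_on f (crossing ` set w)"
    and w': "w' = map (rename f) (rotate k w) \<or> w' = map (rename f) (rotate k (rev w))"
    using assms(1) unfolding isotopic_def by blast
  show ?thesis using w' f assms(2)
      interlaced_rename[of f "rotate k w" x y] interlaced_rename[of f "rotate k (rev w)" x y] by auto
qed

text \<open>Consecutive passages of one crossing form an isolated chord: an alternating word of
  \<open>x\<close> and \<open>y\<close> contains no doubled letter.\<close>

lemma interlaced_remove_double:
  assumes "interlaced (u @ [p, q] @ v) x y" "crossing p = crossing q"
  shows "interlaced (u @ v) x y"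
proof (cases "crossing p \<in> {x, y}")
  case True
  have "fu @ [c, c] @ fv \<noteq> [a, b, a, b]" if "a \<noteq> b" for a b c :: nat and fu fv
    using that by (auto simp: append_eq_Cons_conv Cons_eq_append_conv)
  with True assms show ?thesis
    by (auto simp: interlaced_def)
next
  case False
  with assms show ?thesis by (auto simp: interlaced_def)
qed

lemma interlaced_insert:
  assumes "interlaced (u @ v) x y" "crossing p \<notin> crossing ` set (u @ v)" "crossing q = crossing p"
  shows "interlaced (u @ [p, q] @ v) x y"
  using assms interlaced_memD[OF assms(1)] by (auto simp: interlaced_def)

section \<open>Well-formed codes\<close>

lemma well_formed_same_crossingD:
  assumes "well_formed w" "p \<in> set w" "q \<in> set w" "crossing p = crossing q" "p \<noteq> q"
  shows "positive p = positive q" "over p \<noteq> over q"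
proof -
  obtain c a s where p: "p = Passage c a s" by (cases p)
  obtain b t where q: "q = Passage c b t" using assms(4) p by (cases q) auto
  have *: "Passage c (\<not> a') s' \<in> set w \<and> Passage c a' (\<not> s') \<notin> set w" if "Passage c a' s' \<in> set w" for a' s'
    using assms(1) that unfolding well_formed_def by blast
  have "t = s"
  proof (rule ccontr)
    assume "t \<noteq> s"
    then have t: "t = (\<not> s)" by auto
    show False
    proof (cases "b = a")
      case True
      then show ?thesis using *[of a s] assms(2,3) p q t by auto
    next
      case False
      then have "b = (\<not> a)" by auto
      then show ?thesis using *[of a s] *[of "\<not> a" s] assms(2,3) p q t by auto
    qed
  qed
  then show "positive p = positive q" "over p \<noteq> over q" using assms(5) p q by auto
qed

lemma well_formed_no_third:
  assumes "well_formed w" "p \<in> set w" "q \<in> set w" "r \<in> set w"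
    "crossing p = crossing q" "crossing p = crossing r" "p \<noteq> q" "p \<noteq> r"
  shows "q = r"
  using well_formed_same_crossingD(2)[OF assms(1)] assms by metis

lemma well_formed_kink_fresh:
  assumes "well_formed (u @ [Passage c a s, Passage c (\<not> a) s] @ v)"
  shows "c \<notin> crossing ` set (u @ v)"
proof
  assume "c \<in> crossing ` set (u @ v)"
  then obtain p where p: "p \<in> set (u @ v)" "crossing p = c" by auto
  have "p \<noteq> Passage c a s" "p \<noteq> Passage c (\<not> a) s"
    using p(1) assms by (auto simp: well_formed_def)
  then show False
    using well_formed_no_third[OF assms, of p "Passage c a s" "Passage c (\<not> a) s"] p by auto
qed

section \<open>Fortified codes\<close>

text \<open>
  A labelling \<open>h\<close> gives \<open>None\<close> to the core crossings, and to every other crossing the name of the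
  edge of the core on which it lies.  In a padded code every edge of the core carries a non-empty
  tangle, and no edge of the core joins a crossing to itself (last clause).
\<close>

definition label :: "(nat \<Rightarrow> nat option) \<Rightarrow> passage \<Rightarrow> passage + nat" where
  "label h p = (case h (crossing p) of None \<Rightarrow> Inl p | Some t \<Rightarrow> Inr t)"

definition padded :: "(passage + nat) list \<Rightarrow> bool" where
  "padded l \<longleftrightarrow>
     (\<forall>p q. \<not> adjacent l (Inl p) (Inl q)) \<and>
     (\<forall>s t. adjacent l (Inr s) (Inr t) \<longrightarrow> s = t) \<and>
     (\<forall>p q t. adjacent l (Inl p) (Inr t) \<longrightarrow> adjacent l (Inl q) (Inr t) \<longrightarrow>
        crossing p = crossing q \<longrightarrow> p = q)"

text \<open>Padding alone is no restriction, since giving all crossings one edge name makes any code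
  padded. The interlaced core pair is what a circle with kinks cannot offer.\<close>

definition fortified :: "gauss_code \<Rightarrow> bool" where
  "fortified w \<longleftrightarrow> (\<exists>h. padded (map (label h) w) \<and>
     (\<exists>x y. h x = None \<and> h y = None \<and> interlaced w x y))"

section \<open>Fortification under isotopy and kinks\<close>

lemma fortified_rename:
  assumes f: "inj_on f (crossing ` set w)" and "fortified w"
  shows "fortified (map (rename f) w)"
proof -
  obtain h x y where h: "padded (map (label h) w)" and xy: "h x = None" "h y = None" "interlaced w x y"
    using assms(2) unfolding fortified_def by blast
  define h' where "h' = h \<circ> the_inv_into (crossing ` set w) f"
  have h': "h' (f c) = h c" if "c \<in> crossing ` set w" for c
    using that f by (simp add: h'_def the_inv_into_f_f)
  have lab: "map (label h') (map (rename f) w) = map (map_sum (rename f) id) (map (label h) w)"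
    using h' by (auto simp: label_def split: option.split)
  have cr: "crossing p = crossing q" if "f (crossing p) = f (crossing q)"
    "Inl p \<in> set (map (label h) w)" "Inl q \<in> set (map (label h) w)" for p q
  proof -
    have "p \<in> set w" "q \<in> set w" using that(2,3) by (auto simp: label_def split: option.splits)
    then show ?thesis using that(1) f by (auto dest: inj_onD)
  qed
  have InlE: "\<exists>p. z = Inl p \<and> p' = rename f p" if "Inl p' = map_sum (rename f) id z" for z :: "passage + nat" and p'
    using that by (cases z) auto
  have InrE: "z = Inr t" if "Inr t = map_sum (rename f) id z" for z :: "passage + nat" and t
    using that by (cases z) auto
  have "padded (map (map_sum (rename f) id) (map (label h) w))"
    unfolding padded_def
  proof (intro conjI allI impI notI)
    fix p q t assume p: "adjacent (map (map_sum (rename f) id) (map (label h) w)) (Inl p) (Inr t)"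
      and q: "adjacent (map (map_sum (rename f) id) (map (label h) w)) (Inl q) (Inr t)"
      and pq: "crossing p = crossing q"
    obtain p' where p': "p = rename f p'" "adjacent (map (label h) w) (Inl p') (Inr t)"
      using p unfolding adjacent_map[of "map_sum _ _"] by (auto dest!: InlE InrE)
    obtain q' where q': "q = rename f q'" "adjacent (map (label h) w) (Inl q') (Inr t)"
      using q unfolding adjacent_map[of "map_sum _ _"] by (auto dest!: InlE InrE)
    have "crossing p' = crossing q'"
      using pq cr adjacent_memD[OF p'(2)] adjacent_memD[OF q'(2)] p'(1) q'(1) by simp
    then show "p = q" using h p' q' unfolding padded_def by blast
  qed (use h in \<open>auto simp: padded_def adjacent_map[of "map_sum _ _"] simp del: map_map dest!: InlE InrE\<close>)
  moreover have "h' (f x) = None" "h' (f y) = None"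
    using xy interlaced_memD[OF xy(3)] h' by auto
  ultimately show ?thesis
    using interlaced_rename[OF f xy(3)] unfolding fortified_def lab[symmetric] by blast
qed

lemma fortified_rotate: "fortified w \<Longrightarrow> fortified (rotate k w)"
  by (simp add: fortified_def rotate_map[symmetric] padded_def)

lemma fortified_rev: "fortified w \<Longrightarrow> fortified (rev w)"
  by (simp add: fortified_def rev_map[symmetric] padded_def)

lemma fortified_isotopic:
  assumes "isotopic w w'" "fortified w"
  shows "fortified w'"
proof -
  obtain f k where f: "inj_on f (crossing ` set w)"
    and w': "w' = map (rename f) (rotate k w) \<or> w' = map (rename f) (rotate k (rev w))"
    using assms(1) unfolding isotopic_def by blast
  show ?thesis using w' f assms(2) fortified_rotate fortified_rev
      fortified_rename[of f "rotate k w"] fortified_rename[of f "rotate k (rev w)"] by auto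
qed

text \<open>Core letters are never adjacent, so some neighbour of the insertion point carries an
  edge name. The new crossing takes that name, which lengthens a tangle and leaves the core
  alone.\<close>

lemma fortified_kink:
  assumes fort: "fortified (u @ v)" and fresh: "crossing p \<notin> crossing ` set (u @ v)"
    and q: "crossing q = crossing p"
  shows "fortified (u @ [p, q] @ v)"
proof -
  obtain h x y where h: "padded (map (label h) (u @ v))"
    and xy: "h x = None" "h y = None" "interlaced (u @ v) x y"
    using fort unfolding fortified_def by blast
  let ?L = "map (label h)"
  have "?L u @ ?L v \<noteq> []" using xy(3) by (auto simp: interlaced_def)
  then obtain a b where ab: "adjacent (?L u @ ?L v) a b"
    and dup: "\<And>t p q. t \<in> {a, b} \<Longrightarrow> adjacent (?L u @ [t, t] @ ?L v) p q
      \<Longrightarrow> adjacent (?L u @ ?L v) p q \<or> p = t \<and> q = t"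
    by (rule adjacent_duplicate_neighbour) (rule that, assumption, blast)
  obtain t where t: "Inr t \<in> {a, b}"
    using ab h unfolding padded_def map_append[symmetric] by (cases a; cases b) blast+
  define h' where "h' = h(crossing p := Some t)"
  have "map (label h') ws = map (label h) ws" if "set ws \<subseteq> set (u @ v)" for ws
  proof -
    have "crossing z \<noteq> crossing p" if "z \<in> set ws" for z
      using fresh that \<open>set ws \<subseteq> set (u @ v)\<close> by (metis image_eqI subsetD)
    then show ?thesis by (simp add: h'_def label_def)
  qed
  from this[of u] this[of v] have "map (label h') u = ?L u" "map (label h') v = ?L v" by simp_all
  then have "map (label h') (u @ [p, q] @ v) = ?L u @ [Inr t, Inr t] @ ?L v"
    using q by (simp add: h'_def label_def)
  moreover have "padded (?L u @ [Inr t, Inr t] @ ?L v)"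
    using h dup[OF t] unfolding padded_def map_append by blast
  moreover have "h' x = None" "h' y = None"
  proof -
    have "x \<noteq> crossing p" "y \<noteq> crossing p" using fresh interlaced_memD[OF xy(3)] by metis+
    then show "h' x = None" "h' y = None" using xy by (simp_all add: h'_def)
  qed
  moreover have "interlaced (u @ [p, q] @ v) x y"
    using interlaced_insert xy(3) fresh q by blast
  ultimately show ?thesis unfolding fortified_def by metis
qed

text \<open>Core passages survive as letters of the labelled word, so the pattern of two core
  crossings can be read off it.\<close>

lemma interlaced_core_label:
  assumes "h x = None" "h y = None" "map (label h) w = map (label h) w'"
  shows "interlaced w x y \<longleftrightarrow> interlaced w' x y"
proof -
  let ?P = "\<lambda>l. case l of Inl p \<Rightarrow> crossing p \<in> {x, y} | Inr _ \<Rightarrow> False"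
  have "filter (\<lambda>c. c \<in> {x, y}) (map crossing w)
      = map (crossing \<circ> projl) (filter ?P (map (label h) w))" for w
    using assms(1,2) by (induction w) (auto simp: label_def split: option.splits)
  then show ?thesis using assms(3) by (simp add: interlaced_def)
qed

text \<open>Pigeonhole: \<open>over\<close> is injective on the passages of one crossing, so each
  crossing contributes at most two to \<open>P\<close>. If \<open>p\<close> were alone, the
  remaining 2k - 1 passages would lie on k - 1 crossings, k being the number of crossings of
  \<open>P\<close>.\<close>

lemma well_formed_saturated:
  assumes w: "well_formed w" and P: "P \<subseteq> set w" "card P = 2 * card (crossing ` P)" and p: "p \<in> P"
  shows "\<exists>q \<in> P. q \<noteq> p \<and> crossing q = crossing p"
proof (rule ccontr)
  assume no: "\<not> ?thesis"
  have fin: "finite P" using P(1) finite_subset by blast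
  define S where "S = P - {p}"
  have im: "crossing ` S = crossing ` P - {crossing p}" using no p by (auto simp: S_def)
  have fibre: "card {x \<in> S. crossing x = y} \<le> 2" for y
  proof -
    have "inj_on over {x \<in> S. crossing x = y}"
      using well_formed_same_crossingD(2)[OF w] P(1) by (intro inj_onI) (auto simp: S_def)
    then have "card {x \<in> S. crossing x = y} \<le> card (UNIV :: bool set)"
      by (intro card_inj_on_le) auto
    then show ?thesis by simp
  qed
  have "card S = (\<Sum>y\<in>crossing ` S. card {x \<in> S. crossing x = y})"
    using sum.image_gen[of S "\<lambda>_. 1 :: nat" crossing] fin by (simp add: S_def)
  also have "\<dots> \<le> card (crossing ` S) * 2"
    using sum_bounded_above[of "crossing ` S" "\<lambda>y. card {x \<in> S. crossing x = y}" 2] fibre by simp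
  finally have "card P - 1 \<le> (card (crossing ` P) - 1) * 2"
    using p fin by (simp add: im) (simp add: S_def)
  moreover have "card (crossing ` P) \<ge> 1" using p fin by (simp add: Suc_le_eq card_gt_0_iff) blast
  ultimately show False using P(2) by linarith
qed

text \<open>
  If \<open>a\<close> were a core passage, the partners of the two passages of its crossing would lie on the same
  edge of the core: they are passages of one crossing, or the third pair joins their crossings.
\<close>

lemma padded_swap_not_core:
  assumes w: "well_formed w" and P: "{a, a', b, b', c, c'} \<subseteq> set w" "distinct [a, a', b, b', c, c']"
    "card (crossing ` {a, a', b, b', c, c'}) = 3"
    and h: "padded (map (label h) w)"
    and adj: "\<And>p q. (p, q) \<in> {(a, a'), (b, b'), (c, c')} \<Longrightarrow>
      adjacent (map (label h) w) (label h p) (label h q)"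
  shows "h (crossing a) \<noteq> None"
proof
  let ?A = "\<lambda>p q. adjacent (map (label h) w) (label h p) (label h q)"
  let ?P = "{a, a', b, b', c, c'}"
  assume core: "h (crossing a) = None"
  have "card ?P = 6" using P(2) by simp
  then have other: "\<exists>q \<in> ?P. q \<noteq> p \<and> crossing q = crossing p" if "p \<in> ?P" for p
    using well_formed_saturated[OF w P(1) _ that] P(3) by simp
  \<comment> \<open>\<open>h1\<close>, \<open>h2\<close> and \<open>h3\<close> are the three clauses
    of \<open>padded\<close>, restated for the labels of crossings.\<close>
  have h1: "h (crossing q) \<noteq> None" if "?A p q" "h (crossing p) = None" for p q
    using that h by (auto simp: padded_def label_def split: option.splits)
  have h2: "h (crossing p) = h (crossing q)"
    if "?A p q" "h (crossing p) \<noteq> None" "h (crossing q) \<noteq> None" for p q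
    using that h by (auto simp: padded_def label_def)
  have h3: "h (crossing u) \<noteq> h (crossing v)"
    if A: "?A p u" "?A q v" and p: "h (crossing p) = None" "crossing p = crossing q" "p \<noteq> q" for p q u v
  proof
    assume eq: "h (crossing u) = h (crossing v)"
    obtain t where "h (crossing u) = Some t" using h1[OF A(1) p(1)] by auto
    then have "?A p u = adjacent (map (label h) w) (Inl p) (Inr t)"
      "?A q v = adjacent (map (label h) w) (Inl q) (Inr t)"
      using p eq by (simp_all add: label_def)
    then show False using A p h unfolding padded_def by blast
  qed
  \<comment> \<open>\<open>d\<close> is the other passage of the crossing of \<open>a\<close>, and
    \<open>e\<close>, \<open>e'\<close> is the third pair. The partners of \<open>a'\<close> and
    \<open>d'\<close> are neither core nor each other, so both crossings recur in \<open>e\<close>,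
    \<open>e'\<close>, whose labels agree; but \<open>h3\<close> separates the labels of
    \<open>a'\<close> and \<open>d'\<close>.\<close>
  have no: False if A: "?A d d'" "?A e e'" and P': "?P = {a, a', d, d', e, e'}" "distinct [a, a', d, d', e, e']"
    and d: "crossing d = crossing a" for d d' e e'
  proof -
    have aa': "?A a a'" using adj by blast
    have na: "h (crossing a') \<noteq> None" "h (crossing d') \<noteq> None"
      using h1[OF aa'] h1[OF A(1)] core d by auto
    have ne: "h (crossing a') \<noteq> h (crossing d')" using h3[OF aa' A(1) core d[symmetric]] P'(2) by simp
    have e: "crossing q = crossing e \<or> crossing q = crossing e'" if "q \<in> {a', d'}" for q
    proof -
      have "q \<in> ?P" unfolding P' using that by blast
      then obtain q' where q': "q' \<in> {a, a', d, d', e, e'}" "q' \<noteq> q" "crossing q' = crossing q"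
        using other unfolding P' by blast
      have "q' \<notin> {a, d}" using q'(3) that na core d by auto
      moreover have "q' \<notin> {a', d'}" using q'(2,3) that ne by auto
      ultimately show ?thesis using q' by auto
    qed
    have "crossing a' \<noteq> crossing d'" using ne by auto
    then have "h (crossing e) = h (crossing a') \<and> h (crossing e') = h (crossing d')
      \<or> h (crossing e) = h (crossing d') \<and> h (crossing e') = h (crossing a')"
      using e[of a'] e[of d'] by auto
    then show False using h2[OF A(2)] na ne by auto
  qed
  have ab: "?A a a'" "?A b b'" "?A c c'" using adj by simp_all
  have ba: "?A b' b" "?A c' c" by (rule adjacent_sym, rule ab)+
  \<comment> \<open>A core passage has no core neighbour, so the partner of \<open>a\<close> is one
    of the four passages of the other two pairs.\<close>
  have "crossing a' \<noteq> crossing a" using h1[OF ab(1)] core by auto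
  then consider "crossing b = crossing a" | "crossing b' = crossing a" | "crossing c = crossing a"
    | "crossing c' = crossing a"
    using other[of a] by (metis insertE singletonD insertI1)
  then show False
  proof cases
    case 1
    show ?thesis
    proof (rule no[OF ab(2) ab(3) _ _ 1])
      show "?P = {a, a', b, b', c, c'}" by blast
      show "distinct [a, a', b, b', c, c']" using P(2) by auto
    qed
  next
    case 2
    show ?thesis
    proof (rule no[OF ba(1) ab(3) _ _ 2])
      show "?P = {a, a', b', b, c, c'}" by blast
      show "distinct [a, a', b', b, c, c']" using P(2) by auto
    qed
  next
    case 3
    show ?thesis
    proof (rule no[OF ab(3) ab(2) _ _ 3])
      show "?P = {a, a', c, c', b, b'}" by blast
      show "distinct [a, a', c, c', b, b']" using P(2) by auto
    qed
  next
    case 4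
    show ?thesis
    proof (rule no[OF ba(2) ab(2) _ _ 4])
      show "?P = {a, a', c', c, b, b'}" by blast
      show "distinct [a, a', c', c, b, b']" using P(2) by auto
    qed
  qed
qed

text \<open>With no core passage involved, the two entries of each exchanged pair carry the same
  label. The labelled word is then unchanged and the same \<open>h\<close> serves the new
  code.\<close>

lemma fortified_swap:
  assumes w: "well_formed w" and eq: "w = p @ [a, a'] @ q @ [b, b'] @ r @ [c, c'] @ t"
    and card: "card (crossing ` {a, a', b, b', c, c'}) = 3" and "fortified w"
  shows "fortified (p @ [a', a] @ q @ [b', b] @ r @ [c', c] @ t)" (is "fortified ?w'")
proof -
  obtain h x y where h: "padded (map (label h) w)"
    and xy: "h x = None" "h y = None" "interlaced w x y"
    using assms(4) unfolding fortified_def by blast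
  let ?L = "label h"
  have adj: "adjacent (map ?L w) (?L a) (?L a')" "adjacent (map ?L w) (?L b) (?L b')"
    "adjacent (map ?L w) (?L c) (?L c')"
    using adjacent_infix[of "map ?L p" "?L a" "?L a'"]
      adjacent_infix[of "map ?L (p @ [a, a'] @ q)" "?L b" "?L b'"]
      adjacent_infix[of "map ?L (p @ [a, a'] @ q @ [b, b'] @ r)" "?L c" "?L c'"]
    unfolding eq by simp_all
  have P: "distinct [a, a', b, b', c, c']" "{a, a', b, b', c, c'} \<subseteq> set w"
    using w unfolding well_formed_def eq by auto
  \<comment> \<open>The lemma speaks of its first passage only; permuting the pairs and turning them
    round reaches all six.\<close>
  note nc = padded_swap_not_core[OF w _ _ _ h]
  have "h (crossing z) \<noteq> None" if "z \<in> {a, a', b, b', c, c'}" for z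
    using that
  proof (elim insertE emptyE; hypsubst)
    show "h (crossing a) \<noteq> None" by (rule nc[of a a' b b' c c']) (use P card adj in auto)
    show "h (crossing b) \<noteq> None"
      by (rule nc[of b b' a a' c c']) (use P card adj in \<open>auto simp: insert_commute\<close>)
    show "h (crossing c) \<noteq> None"
      by (rule nc[of c c' b b' a a']) (use P card adj in \<open>auto simp: insert_commute\<close>)
    show "h (crossing a') \<noteq> None"
      by (rule nc[of a' a b b' c c']) (use P card adj in \<open>auto simp: insert_commute intro: adjacent_sym\<close>)
    show "h (crossing b') \<noteq> None"
      by (rule nc[of b' b a a' c c']) (use P card adj in \<open>auto simp: insert_commute intro: adjacent_sym\<close>)
    show "h (crossing c') \<noteq> None"
      by (rule nc[of c' c b b' a a']) (use P card adj in \<open>auto simp: insert_commute intro: adjacent_sym\<close>)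
  qed
  moreover have "?L z = ?L z'" if "adjacent (map ?L w) (?L z) (?L z')"
    "h (crossing z) \<noteq> None" "h (crossing z') \<noteq> None" for z z'
    using that h by (auto simp: padded_def label_def)
  ultimately have "?L a = ?L a'" "?L b = ?L b'" "?L c = ?L c'"
    using adj by simp_all
  then have L: "map ?L w = map ?L ?w'" by (simp add: eq)
  then show ?thesis
    using h xy interlaced_core_label[OF xy(1,2) L] unfolding fortified_def by metis
qed

section \<open>Orbits\<close>

text \<open>\<open>orbit\<close> collects the positive iterates, so the claim is that
  \<open>x\<close> is periodic. Finiteness makes two iterates coincide and injectivity cancels their
  common part.\<close>

lemma self_in_orbit_finite:
  assumes "finite A" "inj_on f A" "f ` A \<subseteq> A" "x \<in> A"
  shows "x \<in> orbit f x"
proof -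
  have it: "(f ^^ k) x \<in> A" for k using assms(3,4) by (induction k) auto
  have "\<not> inj (\<lambda>k. (f ^^ k) x)"
    using it assms(1) by (meson finite_imageD finite_subset image_subsetI infinite_UNIV_nat)
  then obtain i j where ij: "i < j" "(f ^^ i) x = (f ^^ j) x"
    unfolding inj_def by (metis linorder_neqE_nat)
  have "(f ^^ (j - i)) x = x" using ij
  proof (induction i arbitrary: j)
    case (Suc i)
    then obtain j' where j: "j = Suc j'" by (cases j) auto
    have "(f ^^ i) x = (f ^^ j') x"
      using Suc.prems(2) inj_onD[OF assms(2)] it by (simp add: j)
    then show ?case using Suc.IH[of j'] Suc.prems(1) j by simp
  qed simp
  then show ?thesis unfolding orbit_altdef using ij(1) by (metis (mono_tags, lifting) mem_Collect_eq zero_less_diff)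
qed

lemma orbit_eq_set_cycle:
  assumes "map f xs = rotate1 xs" "x \<in> set xs"
  shows "orbit f x = set xs"
proof
  have closed: "f y \<in> set xs" if "y \<in> set xs" for y
    using that assms(1) by (metis image_eqI list.set_map set_rotate1)
  show "orbit f x \<subseteq> set xs"
  proof
    fix y assume "y \<in> orbit f x"
    then show "y \<in> set xs" by induction (use assms(2) closed in auto)
  qed
  have it: "map (f ^^ k) xs = rotate k xs" for k
  proof (induction k)
    case (Suc k)
    have "map (f ^^ Suc k) xs = map f (rotate k xs)" by (simp flip: Suc)
    also have "\<dots> = rotate (Suc k) xs" by (simp add: rotate_map[symmetric] assms(1) rotate1_rotate_swap)
    finally show ?case .
  qed simp
  show "set xs \<subseteq> orbit f x"
  proof
    fix y assume "y \<in> set xs"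
    then obtain i j where i: "i < length xs" "x = xs ! i" and j: "j < length xs" "y = xs ! j"
      using assms(2) by (metis in_set_conv_nth)
    \<comment> \<open>Adding \<open>length xs\<close> keeps the exponent positive even if
      \<open>j\<close> \<le> \<open>i\<close>, as \<open>orbit\<close> demands at least one
      step.\<close>
    let ?k = "length xs + j - i"
    have "(f ^^ ?k) x = map (f ^^ ?k) xs ! i" using i by simp
    also have "\<dots> = y" using i j by (simp add: it nth_rotate)
    finally show "y \<in> orbit f x" unfolding orbit_altdef using i by auto
  qed
qed

text \<open>
  Inserting elements into the cycles of \<open>f\<close>: the element \<open>b\<close> of the longer cycle of \<open>g\<close> lies
  between \<open>e (r b)\<close> and \<open>e (f (r b))\<close>.
\<close>

lemma card_orbits_refine:
  assumes A: "\<And>a. a \<in> A \<Longrightarrow> f a \<in> A" "\<And>a. a \<in> A \<Longrightarrow> a \<in> orbit f a"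
    and e: "\<And>a. a \<in> A \<Longrightarrow> e a \<in> B" "\<And>a. a \<in> A \<Longrightarrow> r (e a) = a"
    and B: "\<And>b. b \<in> B \<Longrightarrow> g b \<in> B" "\<And>b. b \<in> B \<Longrightarrow> r b \<in> A"
    and step: "\<And>b. b \<in> B \<Longrightarrow> r (g b) = r b \<or> r (g b) = f (r b)"
    and reach: "\<And>b. b \<in> B \<Longrightarrow> e (f (r b)) \<in> orbit g b"
      "\<And>b. b \<in> B \<Longrightarrow> b = e (r b) \<or> b \<in> orbit g (e (r b))"
  shows "card (orbit g ` B) = card (orbit f ` A)"
proof -
  \<comment> \<open>An orbit of \<open>g\<close> is the full preimage under \<open>r\<close> of an
    orbit of \<open>f\<close>: \<open>step\<close> keeps it inside, \<open>reach\<close> fills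
    it.\<close>
  have orb: "orbit g b = {b' \<in> B. r b' \<in> orbit f (r b)}" if b: "b \<in> B" for b
  proof (intro equalityI subsetI)
    fix b' assume "b' \<in> orbit g b"
    then have "b' \<in> B \<and> r b' \<in> orbit f (r b)"
    proof induction
      case base
      show ?case using B step[OF b] A(2) b by (metis orbit.base)
    next
      case (step y)
      then show ?case using B assms(7)[of y] by (metis orbit.step)
    qed
    then show "b' \<in> {b' \<in> B. r b' \<in> orbit f (r b)}" by simp
  next
    fix b' assume "b' \<in> {b' \<in> B. r b' \<in> orbit f (r b)}"
    then have b': "b' \<in> B" "r b' \<in> orbit f (r b)" by auto
    have "a \<in> A \<and> e a \<in> orbit g b" if "a \<in> orbit f (r b)" for a
      using that
    proof induction
      case base
      show ?case using A(1) B(2) reach(1) b by blast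
    next
      case (step a)
      have "e (f a) \<in> orbit g (e a)" using reach(1)[of "e a"] step e by auto
      then show ?case using step A(1) orbit_trans by metis
    qed
    then have "e (r b') \<in> orbit g b" using b'(2) by blast
    then show "b' \<in> orbit g b" using reach(2)[OF b'(1)] orbit_trans by metis
  qed
  \<comment> \<open>Taking preimages matches the orbits bijectively; it is injective because
    \<open>r\<close> maps \<open>B\<close> onto \<open>A\<close>.\<close>
  define pre where "pre O' = {b' \<in> B. r b' \<in> O'}" for O'
  have sub: "orbit f a \<subseteq> A" if "a \<in> A" for a
  proof
    fix x assume "x \<in> orbit f a" then show "x \<in> A" by induction (use that A(1) in auto)
  qed
  have "orbit g ` B = pre ` orbit f ` A"
  proof -
    have "orbit g ` B = (\<lambda>b. pre (orbit f (r b))) ` B"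
      using orb by (auto simp: pre_def)
    also have "\<dots> = pre ` orbit f ` r ` B" by (simp add: image_image)
    also have "r ` B = A" using B(2) e by force
    finally show ?thesis .
  qed
  moreover have "inj_on pre (orbit f ` A)"
  proof (rule inj_on_inverseI)
    fix S assume "S \<in> orbit f ` A"
    then have "S \<subseteq> A" using sub by auto
    then show "r ` pre S = S" using e by (force simp: pre_def)
  qed
  ultimately show ?thesis by (simp add: card_image)
qed

section \<open>Faces\<close>

lemma mate_eqI:
  assumes "well_formed w" "i < length w" "j < length w" "j \<noteq> i" "crossing (w ! j) = crossing (w ! i)"
  shows "mate w i = j"
  unfolding mate_def
proof (rule the_equality)
  fix k assume k: "k < length w \<and> k \<noteq> i \<and> crossing (w ! k) = crossing (w ! i)"
  have d: "distinct w" using assms(1) by (simp add: well_formed_def)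
  have "w ! k = w ! j"
    using k assms d by (intro well_formed_no_third[OF assms(1), of "w ! i"]) (auto simp: nth_eq_iff_index_eq)
  then show "k = j" using d k assms by (simp add: nth_eq_iff_index_eq)
qed (use assms in simp)

lemma mate:
  assumes w: "well_formed w" and i: "i < length w"
  shows "mate w i < length w" "mate w i \<noteq> i" "crossing (w ! mate w i) = crossing (w ! i)"
    "mate w (mate w i) = i"
proof -
  obtain c a s where p: "w ! i = Passage c a s" by (cases "w ! i")
  then have "Passage c (\<not> a) s \<in> set w"
    using w i nth_mem[OF i] unfolding well_formed_def by metis
  then obtain j where j: "j < length w" "w ! j = Passage c (\<not> a) s" by (auto simp: in_set_conv_nth)
  then have j': "j \<noteq> i" "crossing (w ! j) = crossing (w ! i)" using p by auto
  have m: "mate w i = j" using mate_eqI[OF w i j(1) j'] .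
  show "mate w i < length w" "mate w i \<noteq> i" "crossing (w ! mate w i) = crossing (w ! i)"
    using m j j' by auto
  show "mate w (mate w i) = i" unfolding m using j' j(1) i by (intro mate_eqI[OF w]) auto
qed

lemma Suc_mod_eq: "i < n \<Longrightarrow> (i + 1) mod n = (if i + 1 = n then 0 else i + 1)" for i n :: nat
  by (cases "i + 1 = n") simp_all

lemma pred_mod_eq: "i < n \<Longrightarrow> (i + n - 1) mod n = (if i = 0 then n - 1 else i - 1)" for i n :: nat
  by (auto simp: mod_if)

lemma flip_eq:
  assumes "i < length w"
  shows "flip w (i, b) =
    (if b then (if i + 1 = length w then 0 else i + 1, False)
     else (if i = 0 then length w - 1 else i - 1, True))"
  using Suc_mod_eq[OF assms] pred_mod_eq[OF assms] by (cases b) simp_all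

lemma flip_flip: "d \<in> darts w \<Longrightarrow> flip w (flip w d) = d"
  by (cases d; cases "length w") (auto simp: darts_def flip_eq simp del: flip.simps split: if_splits)

lemma flip_darts: "d \<in> darts w \<Longrightarrow> flip w d \<in> darts w"
  by (cases d) (auto simp: darts_def flip_eq simp del: flip.simps)

lemma face_next_darts:
  assumes "well_formed w" "d \<in> darts w"
  shows "face_next w d \<in> darts w"
  using flip_darts[OF assms(2)] mate(1)[OF assms(1)]
  by (cases "flip w d") (simp add: face_next_def darts_def)

lemma inj_on_face_next:
  assumes "well_formed w"
  shows "inj_on (face_next w) (darts w)"
proof -
  have "inj_on (flip w) (darts w)" by (rule inj_on_inverseI) (rule flip_flip)
  moreover have "inj_on (rot w) (darts w)"
  proof (rule inj_onI; clarify)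
    fix i b j b' assume d: "(i, b) \<in> darts w" "(j, b') \<in> darts w" "rot w (i, b) = rot w (j, b')"
    then have "mate w i = mate w j" by simp
    then have "i = j" using d(1,2) mate(4)[OF assms] by (metis SigmaE darts_def lessThan_iff prod.inject)
    then show "i = j \<and> b = b'" using d(3) by (auto split: if_splits)
  qed
  ultimately have "inj_on (rot w \<circ> flip w) (darts w)"
    using flip_darts by (intro comp_inj_on) (auto intro: inj_on_subset)
  moreover have "face_next w = rot w \<circ> flip w" by (auto simp: face_next_def)
  ultimately show ?thesis by simp
qed

lemma face_next_self_in_orbit:
  assumes "well_formed w" "d \<in> darts w"
  shows "d \<in> orbit (face_next w) d"
proof (rule self_in_orbit_finite)
  show "finite (darts w)" by (simp add: darts_def)
  show "face_next w ` darts w \<subseteq> darts w" using face_next_darts[OF assms(1)] by blast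
qed (use assms inj_on_face_next in auto)

text \<open>A certificate for explicit codes: cycles that cover all darts are the faces, with no
  orbit to compute.\<close>

lemma faces_eq_cycles:
  assumes "\<And>xs. xs \<in> set xss \<Longrightarrow> map (face_next w) xs = rotate1 xs"
    and "\<Union> (set ` set xss) = darts w" "[] \<notin> set xss"
  shows "faces w = set ` set xss"
proof -
  have "orbit (face_next w) ` set xs = {set xs}" if "xs \<in> set xss" for xs
    using orbit_eq_set_cycle[OF assms(1)[OF that]] that assms(3) by auto (metis hd_in_set imageI)
  then show ?thesis unfolding faces_def assms(2)[symmetric] image_Union by auto
qed

lemma card_sets_of_distinct_concat:
  assumes "distinct (concat xss)" "[] \<notin> set xss"
  shows "card (set ` set xss) = length xss"
  using assms
proof (induction xss)
  case (Cons xs xss)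
  have "set xs \<notin> set ` set xss"
  proof
    assume "set xs \<in> set ` set xss"
    then have "set xs \<subseteq> set (concat xss)" by auto
    moreover have "set xs \<inter> set (concat xss) = {}" using Cons.prems(1) by simp
    ultimately have "set xs = {}" by (metis inf.absorb1)
    then show False using Cons.prems(2) by simp
  qed
  then show ?case using Cons by simp
qed simp

section \<open>Inserting a kink\<close>

lemma well_formed_insert_kink:
  assumes "well_formed (u @ v)" "c \<notin> crossing ` set (u @ v)"
  shows "well_formed (u @ [Passage c a s, Passage c (\<not> a) s] @ v)"
proof -
  have "Passage c b t \<notin> set (u @ v)" for b t using assms(2) by force
  then show ?thesis using assms(1) unfolding well_formed_def by auto
qed

context
  fixes u v :: gauss_code and c :: nat and a s :: bool
  assumes w: "well_formed (u @ v)" and v: "v \<noteq> []" and fresh: "c \<notin> crossing ` set (u @ v)"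
begin

private definition w0 where "w0 = u @ v"
private definition w1 where "w1 = u @ [Passage c a s, Passage c (\<not> a) s] @ v"
private definition n where "n = length u"
private definition N where "N = length w0"

private definition shift :: "nat \<Rightarrow> nat" where "shift i = (if i < n then i else i + 2)"
private definition sh :: "dart \<Rightarrow> dart" where "sh d = (shift (fst d), snd d)"

text \<open>The two darts of the edge that receives the kink.\<close>

private definition d1 :: dart where "d1 = (if n = 0 then N - 1 else n - 1, True)"
private definition d2 :: dart where "d2 = (n, False)"

text \<open>\<open>eps\<close> holds iff the monogon lies to the right of the direction of travel;
  \<open>lp\<close> is the dart of the loop edge that has the monogon on its right.\<close>

private definition eps where "eps \<longleftrightarrow> a = s"
private definition lp :: dart where "lp = (if eps then (n, True) else (n + 1, False))"

text \<open>The old dart whose face step a new dart subdivides. Apart from \<open>lp\<close>, three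
  darts are new: two of them fall into the step of one of \<open>d1\<close>, \<open>d2\<close> and
  one into the step of the other, as \<open>eps\<close> decides.\<close>

private definition owner :: "dart \<Rightarrow> dart" where
  "owner d = (if fst d < n then d else if fst d \<ge> n + 2 then (fst d - 2, snd d)
     else if fst d = (if eps then n + 1 else n) then (if eps then d1 else d2)
     else (if eps then d2 else d1))"

private lemma wf1: "well_formed w1"
  unfolding w1_def by (rule well_formed_insert_kink[OF w fresh])

private lemma wf0: "well_formed w0" using w by (simp add: w0_def)

private lemma nN: "n < N" using v by (simp add: n_def N_def w0_def)

private lemma len: "length w1 = N + 2" "length w0 = N" by (simp_all add: w1_def w0_def N_def)

private lemma nth_shift: "w1 ! shift i = w0 ! i"
proof (cases "i < n")
  case False
  then obtain k where "i = n + k" by (metis le_Suc_ex not_less)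
  then show ?thesis by (simp add: w1_def w0_def shift_def n_def nth_append)
qed (simp add: w1_def w0_def shift_def n_def nth_append)

private lemma nth_n: "w1 ! n = Passage c a s" "w1 ! (n + 1) = Passage c (\<not> a) s"
  by (simp_all add: w1_def n_def nth_append)

private lemma shift_less: "i < N \<Longrightarrow> shift i < length w1"
  using nN by (auto simp: shift_def len)

private lemma mate_shift: "i < N \<Longrightarrow> mate w1 (shift i) = shift (mate w0 i)"
  using mate[OF wf0, of i] shift_less[of i] shift_less[of "mate w0 i"]
  by (intro mate_eqI[OF wf1]) (auto simp: nth_shift len, auto simp: shift_def split: if_splits)

private lemma mate_kink: "mate w1 n = n + 1" "mate w1 (n + 1) = n"
  using nN by (auto intro!: mate_eqI[OF wf1] simp: nth_n nth_n[unfolded One_nat_def add_Suc_right add_0_right] len)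

private lemma rot_sh: "d \<in> darts w0 \<Longrightarrow> rot w1 (sh d) = sh (rot w0 d)"
  by (cases d) (simp add: sh_def mate_shift nth_shift darts_def len)

private lemma rot_kink:
  "rot w1 (n, b) = (n + 1, if eps then b else \<not> b)"
  "rot w1 (n + 1, b) = (n, if eps then \<not> b else b)"
  unfolding rot.simps mate_kink nth_n by (auto simp: eps_def)

private lemma flip_sh:
  assumes "d \<in> darts w0" "d \<noteq> d1" "d \<noteq> d2"
  shows "flip w1 (sh d) = sh (flip w0 d)"
proof -
  obtain i b where d: "d = (i, b)" by (cases d)
  have i: "i < N" using assms(1) by (simp add: d darts_def len)
  then have "flip w1 (shift i, b) = sh (flip w0 (i, b))"
    using assms(2,3) shift_less[OF i] nN
    by (subst (1 2) flip_eq) (auto simp: len d sh_def d1_def d2_def shift_def split: if_splits)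
  then show ?thesis by (simp add: d sh_def)
qed

private lemma flip_d1d2: "flip w0 d1 = d2" "flip w0 d2 = d1"
  using nN by (auto simp: d1_def d2_def flip_eq len simp del: flip.simps)

private lemma flip_w1:
  "flip w1 (sh d1) = (n, False)" "flip w1 (n, False) = sh d1"
  "flip w1 (sh d2) = (n + 1, True)" "flip w1 (n + 1, True) = sh d2"
  "flip w1 (n, True) = (n + 1, False)" "flip w1 (n + 1, False) = (n, True)"
  using nN by (auto simp: d1_def d2_def sh_def shift_def flip_eq len simp del: flip.simps)

private lemma d12: "d1 \<in> darts w0" "d2 \<in> darts w0"
  using nN by (auto simp: d1_def d2_def darts_def len)

private lemma next_sh:
  assumes "d \<in> darts w0" "d \<noteq> d1" "d \<noteq> d2"
  shows "face_next w1 (sh d) = sh (face_next w0 d)"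
  using rot_sh flip_darts assms by (simp add: face_next_def flip_sh)

text \<open>The step from \<open>d1\<close> is subdivided by \<open>(n + 1, True)\<close>, preceded
  by \<open>(n + 1, False)\<close> if \<open>eps\<close>; the step from \<open>d2\<close> by
  \<open>(n, False)\<close>, preceded by \<open>(n, True)\<close> if not \<open>eps\<close>.\<close>

private lemma next_w1:
  "eps \<Longrightarrow> face_next w1 (sh d1) = (n + 1, False)"
  "eps \<Longrightarrow> face_next w1 (n + 1, False) = (n + 1, True)"
  "face_next w1 (n + 1, True) = sh (face_next w0 d1)"
  "eps \<Longrightarrow> face_next w1 (sh d2) = (n, False)"
  "face_next w1 (n, False) = sh (face_next w0 d2)"
  "\<not> eps \<Longrightarrow> face_next w1 (sh d1) = (n + 1, True)"
  "\<not> eps \<Longrightarrow> face_next w1 (sh d2) = (n, True)"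
  "\<not> eps \<Longrightarrow> face_next w1 (n, True) = (n, False)"
  unfolding face_next_def flip_w1 rot_kink rot_sh[OF d12(1)] rot_sh[OF d12(2)] flip_d1d2 by simp_all

private lemma next_lp: "face_next w1 lp = lp"
proof (cases "eps")
  case True
  then have "lp = (n, True)" by (simp add: lp_def)
  then show ?thesis using True unfolding face_next_def by (simp only: flip_w1 rot_kink if_True simp_thms)
next
  case False
  then have "lp = (n + 1, False)" by (simp add: lp_def)
  then show ?thesis using False unfolding face_next_def by (simp only: flip_w1 rot_kink if_False simp_thms)
qed

private lemma owner_sh: "owner (sh d) = d"
  by (cases d) (auto simp: owner_def sh_def shift_def)

private lemma owner_darts: "d \<in> darts w1 \<Longrightarrow> owner d \<in> darts w0"
  using d12 nN by (auto simp: owner_def darts_def len)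

private lemma owner_kink:
  "eps \<Longrightarrow> owner (n + 1, b) = d1" "eps \<Longrightarrow> owner (n, b) = d2"
  "\<not> eps \<Longrightarrow> owner (n, b) = d2" "\<not> eps \<Longrightarrow> owner (n + 1, b) = d1"
  by (simp_all add: owner_def)

private lemma darts_w1:
  assumes "d \<in> darts w1 - {lp}"
  obtains d' where "d = sh d'" "d' \<in> darts w0" | "d = (n + 1, True)"
    | "eps" "d = (n + 1, False)" | "d = (n, False)" | "\<not> eps" "d = (n, True)"
proof -
  obtain i b where d: "d = (i, b)" by (cases d)
  have i: "i < N + 2" using assms by (simp add: d darts_def len)
  consider "i < n" | "i = n" | "i = n + 1" | "i \<ge> n + 2" by linarith
  then show thesis
  proof cases
    case 1
    then show ?thesis using that(1)[of d] nN by (simp add: d sh_def shift_def darts_def len)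
  next
    case 4
    then have "i = shift (i - 2)" "i - 2 < N" using i by (auto simp: shift_def)
    then show ?thesis using that(1)[of "(i - 2, b)"] by (simp add: d sh_def darts_def len)
  qed (use assms that in \<open>auto simp: d lp_def split: if_splits\<close>)
qed

private lemma sh_darts: "d \<in> darts w0 \<Longrightarrow> sh d \<in> darts w1 - {lp}"
  by (auto simp: sh_def shift_def darts_def len lp_def split: if_splits)

text \<open>The stepping and reachability hypotheses of \<open>card_orbits_refine\<close>, with
  \<open>sh\<close> embedding the old darts and \<open>owner\<close> retracting onto them.\<close>

private lemma kink_path:
  assumes d: "d \<in> darts w1 - {lp}"
  shows "owner (face_next w1 d) = owner d \<or> owner (face_next w1 d) = face_next w0 (owner d)"
    and "sh (face_next w0 (owner d)) \<in> orbit (face_next w1) d"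
    and "d = sh (owner d) \<or> d \<in> orbit (face_next w1) (sh (owner d))"
proof -
  let ?f = "face_next w1"
  note b = orbit.base[of ?f] and st = orbit.step[of _ ?f] and sub = orbit_subset[of _ ?f]
  have o1: "owner (n + 1, True) = d1" "owner (n, False) = d2" using owner_kink by (cases eps; simp)+
  have p1: "sh (face_next w0 d1) \<in> orbit ?f (n + 1, True)" using b[of "(n + 1, True)"] next_w1 by simp
  have p2: "sh (face_next w0 d2) \<in> orbit ?f (n, False)" using b[of "(n, False)"] next_w1 by simp
  have p3: "sh (face_next w0 d1) \<in> orbit ?f (n + 1, False)" if eps
    using sub[of _ "(n + 1, False)"] p1 next_w1(2)[OF that] by simp
  have p4: "sh (face_next w0 d2) \<in> orbit ?f (n, True)" if "\<not> eps"
    using sub[of _ "(n, True)"] p2 next_w1(8)[OF that] by simp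
  have p5: "sh (face_next w0 d1) \<in> orbit ?f (sh d1)"
    using sub[of _ "sh d1"] p1 p3 next_w1(1,6) by (cases eps) simp_all
  have p6: "sh (face_next w0 d2) \<in> orbit ?f (sh d2)"
    using sub[of _ "sh d2"] p2 p4 next_w1(4,7) by (cases eps) simp_all
  have q1: "(n + 1, False) \<in> orbit ?f (sh d1)" if eps
    using b[of "sh d1"] next_w1(1)[OF that] by simp
  have q2: "(n + 1, True) \<in> orbit ?f (sh d1)"
    using b[of "sh d1"] st[OF q1] next_w1(2,6) by (cases eps) simp_all
  have q3: "(n, True) \<in> orbit ?f (sh d2)" if "\<not> eps"
    using b[of "sh d2"] next_w1(7)[OF that] by simp
  have q4: "(n, False) \<in> orbit ?f (sh d2)"
    using b[of "sh d2"] st[OF q3] next_w1(4,8) by (cases eps) simp_all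
  have r1: "owner (?f (sh d1)) = d1" "owner (?f (sh d2)) = d2"
    using next_w1(1,4,6,7) owner_kink o1 by (cases eps; simp)+
  have "(owner (?f d) = owner d \<or> owner (?f d) = face_next w0 (owner d)) \<and>
    sh (face_next w0 (owner d)) \<in> orbit ?f d \<and> (d = sh (owner d) \<or> d \<in> orbit ?f (sh (owner d)))"
    using d
  proof (cases rule: darts_w1)
    case (1 d')
    consider "d' = d1" | "d' = d2" | "d' \<noteq> d1" "d' \<noteq> d2" by blast
    then show ?thesis
    proof cases
      case 3
      then have "?f d = sh (face_next w0 d')" using next_sh 1 by simp
      then show ?thesis using b[of d] by (simp add: 1 owner_sh)
    qed (use 1 r1 p5 p6 in \<open>simp_all add: owner_sh\<close>)
  next
    case 2
    then show ?thesis using o1 p1 q2 next_w1(3) by (simp add: owner_sh)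
  next
    case 3
    then show ?thesis using o1 p3 q1 next_w1(2) owner_kink(1) by simp
  next
    case 4
    then show ?thesis using o1 p2 q4 next_w1(5) by (simp add: owner_sh)
  next
    case 5
    then show ?thesis using o1 p4 q3 next_w1(8) owner_kink(3) by simp
  qed
  then show "owner (?f d) = owner d \<or> owner (?f d) = face_next w0 (owner d)"
    "sh (face_next w0 (owner d)) \<in> orbit ?f d" "d = sh (owner d) \<or> d \<in> orbit ?f (sh (owner d))"
    by blast+
qed

lemma card_faces_kink:
  "card (faces (u @ [Passage c a s, Passage c (\<not> a) s] @ v)) = card (faces (u @ v)) + 1"
proof -
  have lp: "lp \<in> darts w1" using nN by (auto simp: lp_def darts_def len)
  have orb: "orbit (face_next w1) lp = {lp}" using next_lp by (simp add: orbit_eq_singleton_iff)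
  \<comment> \<open>\<open>lp\<close> is a fixed point of an injective map, so no other dart steps
    into it.\<close>
  have B: "face_next w1 d \<in> darts w1 - {lp}" if "d \<in> darts w1 - {lp}" for d
    using that face_next_darts[OF wf1] inj_onD[OF inj_on_face_next[OF wf1], of d lp] lp next_lp by auto
  have "card (orbit (face_next w1) ` (darts w1 - {lp})) = card (orbit (face_next w0) ` darts w0)"
    by (rule card_orbits_refine[where r = owner and e = sh])
      (use B face_next_darts[OF wf0] face_next_self_in_orbit[OF wf0] sh_darts owner_sh owner_darts kink_path in auto)
  moreover have "{lp} \<notin> orbit (face_next w1) ` (darts w1 - {lp})"
    using face_next_self_in_orbit[OF wf1] by auto
  moreover have "faces w1 = insert {lp} (orbit (face_next w1) ` (darts w1 - {lp}))"
    unfolding faces_def using lp orb by (metis image_insert insert_Diff)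
  ultimately have "card (faces w1) = card (faces w0) + 1"
    unfolding faces_def by (simp add: darts_def)
  then show ?thesis by (simp add: w1_def w0_def)
qed

end

text \<open>One crossing more and one face more: both sides of the Euler equation grow by
  one.\<close>

lemma knot_code_insert_kink:
  assumes "knot_code (u @ v)" "v \<noteq> []" "c \<notin> crossing ` set (u @ v)"
  shows "knot_code (u @ [Passage c a s, Passage c (\<not> a) s] @ v)"
  using assms card_faces_kink[of u v c a s] well_formed_insert_kink[of u v c a s]
  by (simp add: knot_code_def spherical_def)

text \<open>The empty code has no edge dart to subdivide, so the first kink on the circle is traced
  by hand: two monogons and one face with two darts.\<close>

lemma knot_code_figure_eight: "knot_code [Passage c a s, Passage c (\<not> a) s]" (is "knot_code ?w")
proof -
  define w where "w = ?w"
  define e where "e \<longleftrightarrow> a = s"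
  have wf: "well_formed w" by (auto simp: well_formed_def w_def)
  have l: "length w = 2" by (simp add: w_def)
  have m: "mate w 0 = 1" "mate w 1 = 0" by (rule mate_eqI[OF wf]; simp add: w_def)+
  have o: "(over (w ! 0) = positive (w ! 0)) = e" "(over (w ! 1) = positive (w ! 1)) = (\<not> e)"
    by (auto simp: w_def e_def)
  have fl: "flip w (0, True) = (1, False)" "flip w (0, False) = (1, True)"
    "flip w (1, True) = (0, False)" "flip w (1, False) = (0, True)"
    by (simp_all add: l)
  have f: "face_next w (0, True) = (0, e)" "face_next w (0, False) = (0, \<not> e)"
    "face_next w (1, True) = (1, \<not> e)" "face_next w (1, False) = (1, e)"
    unfolding face_next_def fl rot.simps m o by simp_all
  have d: "darts w = {(0, True), (0, False), (1, True), (1, False)}"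
    by (auto simp: darts_def l)
  have "card (faces w) = 3"
  proof (cases e)
    case True
    have "faces w = set ` set [[(0, True)], [(0, False)], [(1, False), (1, True)]]"
      by (rule faces_eq_cycles) (use True f in \<open>auto simp: d\<close>)
    also have "card \<dots> = 3" by (subst card_sets_of_distinct_concat) simp_all
    finally show ?thesis .
  next
    case False
    have "faces w = set ` set [[(1, True)], [(1, False)], [(0, False), (0, True)]]"
      by (rule faces_eq_cycles) (use False f in \<open>auto simp: d\<close>)
    also have "card \<dots> = 3" by (subst card_sets_of_distinct_concat) simp_all
    finally show ?thesis .
  qed
  then show ?thesis using wf by (simp add: knot_code_def spherical_def w_def)
qed

section \<open>Diagrams\<close>

lemma represents_abs: "knot_code w \<Longrightarrow> represents w (abs_knot_diagram w)"
  by (simp add: represents_def)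

lemma represents_isotopic:
  assumes "represents w D" "represents w' D"
  shows "isotopic w w'"
  using assms isotopic_refl Quotient3_rel[OF Quotient3_knot_diagram, of w w']
  by (simp add: represents_def)

section \<open>Effect of the moves on fortified and interlaced diagrams\<close>

definition fortified_diagram :: "knot_diagram \<Rightarrow> bool" where
  "fortified_diagram D \<longleftrightarrow> (\<exists>w. represents w D \<and> fortified w)"

definition interlaced_diagram :: "knot_diagram \<Rightarrow> bool" where
  "interlaced_diagram D \<longleftrightarrow> (\<exists>w x y. represents w D \<and> interlaced w x y)"

lemma fortified_imp_interlaced_diagram: "fortified_diagram D \<Longrightarrow> interlaced_diagram D"
  unfolding fortified_diagram_def interlaced_diagram_def fortified_def by blast

lemma fortified_diagram_iff: "represents w D \<Longrightarrow> fortified_diagram D \<longleftrightarrow> fortified w"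
  unfolding fortified_diagram_def using represents_isotopic fortified_isotopic by blast

lemma fortified_omega1_up:
  assumes "omega1_up D D'" "fortified_diagram D"
  shows "fortified_diagram D'"
proof -
  obtain u v c a s where D: "represents (u @ v) D"
    and D': "represents (u @ [Passage c a s, Passage c (\<not> a) s] @ v) D'"
    using assms(1) unfolding omega1_up_def by blast
  have "c \<notin> crossing ` set (u @ v)"
    using D' well_formed_kink_fresh unfolding represents_def knot_code_def by blast
  then show ?thesis
    using fortified_diagram_iff[OF D] fortified_diagram_iff[OF D'] assms(2)
      fortified_kink[of u v "Passage c a s" "Passage c (\<not> a) s"] by simp
qed

lemma interlaced_omega1_up:
  assumes "omega1_up D D'" "interlaced_diagram D'"
  shows "interlaced_diagram D"
proof -
  obtain u v c a s where D: "represents (u @ v) D"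
    and D': "represents (u @ [Passage c a s, Passage c (\<not> a) s] @ v) D'"
    using assms(1) unfolding omega1_up_def by blast
  obtain x y where "interlaced (u @ [Passage c a s, Passage c (\<not> a) s] @ v) x y"
    using assms(2) D' interlaced_isotopic represents_isotopic unfolding interlaced_diagram_def by metis
  then have "interlaced (u @ v) x y" by (rule interlaced_remove_double) simp
  then show ?thesis using D unfolding interlaced_diagram_def by blast
qed

text \<open>Exchanging the three pairs again restores the code and keeps the set of six passages, so
  \<open>fortified_swap\<close> applies in both directions.\<close>

lemma fortified_omega3:
  assumes "omega3 D D'"
  shows "fortified_diagram D \<longleftrightarrow> fortified_diagram D'"
proof -
  obtain p q r t a a' b b' c c' where
    D: "represents (p @ [a, a'] @ q @ [b, b'] @ r @ [c, c'] @ t) D" (is "represents ?w D") and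
    D': "represents (p @ [a', a] @ q @ [b', b] @ r @ [c', c] @ t) D'" (is "represents ?w' D'") and
    card: "card (crossing ` {a, a', b, b', c, c'}) = 3"
    using assms unfolding omega3_def Let_def by blast
  have wf: "well_formed ?w" "well_formed ?w'"
    using D D' unfolding represents_def knot_code_def by blast+
  have "{a', a, b', b, c', c} = {a, a', b, b', c, c'}" by blast
  then have card': "card (crossing ` {a', a, b', b, c', c}) = 3" using card by simp
  show ?thesis
    using fortified_swap[OF wf(1) refl card] fortified_swap[OF wf(2) refl card']
    unfolding fortified_diagram_iff[OF D] fortified_diagram_iff[OF D'] by blast
qed

lemma not_interlaced_unknot_diagram: "\<not> interlaced_diagram unknot_diagram"
proof
  assume "interlaced_diagram unknot_diagram"
  then obtain w x y where "represents w unknot_diagram" "interlaced w x y"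
    unfolding interlaced_diagram_def by blast
  moreover have "represents [] unknot_diagram"
    by (simp add: represents_def unknot_diagram_def knot_code_Nil)
  ultimately obtain x y where "interlaced [] x y"
    using represents_isotopic interlaced_isotopic by blast
  then show False by (simp add: interlaced_def)
qed

lemma fortified_not_sorted_transformable:
  assumes "fortified_diagram D" "\<not> interlaced_diagram D'"
  shows "\<not> sorted_transformable D D'" "\<not> sorted_transformable D' D"
proof -
  have up: "fortified_diagram F" if "omega1_up\<^sup>*\<^sup>* E F" "fortified_diagram E" for E F
    using that by induction (auto intro: fortified_omega1_up)
  have o3: "fortified_diagram E \<longleftrightarrow> fortified_diagram F" if "omega3\<^sup>*\<^sup>* E F" for E F
    using that by induction (auto simp: fortified_omega3)
  have plain: "\<not> interlaced_diagram F" if "omega1_up\<^sup>*\<^sup>* E F" "\<not> interlaced_diagram E" for E F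
    using that by induction (auto dest: interlaced_omega1_up)
  have down: "omega1_down\<^sup>*\<^sup>* E F \<longleftrightarrow> omega1_up\<^sup>*\<^sup>* F E" for E F
    by (simp add: rtranclp_conversep)
  \<comment> \<open>The two claims differ only in the direction of the third moves. \<open>E\<close>
    is fortified, hence so is \<open>F\<close>, although \<open>F\<close> has no interlaced
    pair.\<close>
  have no: False if "omega1_up\<^sup>*\<^sup>* D E" "omega3\<^sup>*\<^sup>* E F \<or> omega3\<^sup>*\<^sup>* F E" "omega1_up\<^sup>*\<^sup>* D' F" for E F
    using up[OF that(1) assms(1)] o3 that(2) plain[OF that(3) assms(2)]
      fortified_imp_interlaced_diagram by blast
  show "\<not> sorted_transformable D D'" "\<not> sorted_transformable D' D"
    unfolding sorted_transformable_def relcompp_apply down using no by blast+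
qed

section \<open>The family of diagrams\<close>

text \<open>\<open>\<not> True\<close> stays unreduced to match the kink in \<open>omega1_up\<close>
  literally.\<close>

abbreviation (input) kink :: "nat \<Rightarrow> gauss_code" where
  "kink c \<equiv> [Passage c True True, Passage c (\<not> True) True]"

text \<open>The alternating trefoil code with all signs positive, after changing crossings 1 and 2.
  In the triangle to be moved, the arc 0 1 is then on top, 2 0 at the bottom and 1 2 in the
  middle.\<close>

definition trefoil_shadow :: gauss_code where
  "trefoil_shadow = [Passage 0 True True, Passage 1 True False, Passage 2 False False,
     Passage 0 False True, Passage 1 False False, Passage 2 True False]"

text \<open>The trefoil code with the entries exchanged within each of its three consecutive pairs:
  kinks 0 and 2 lie side by side in the loop of crossing 1.\<close>

definition nested_kinks :: gauss_code where
  "nested_kinks = [Passage 1 True False, Passage 0 True True, Passage 0 False True,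
     Passage 2 False False, Passage 2 True False, Passage 1 False False]"

primrec kink_edges :: "nat \<Rightarrow> gauss_code \<Rightarrow> gauss_code" where
  "kink_edges m [] = []"
| "kink_edges m (p # w) = kink m @ p # kink_edges (Suc m) w"

text \<open>A kink on every edge of the trefoil shadow, and \<open>n\<close> more on the edge closing up the code.\<close>

primrec kinked_trefoil :: "nat \<Rightarrow> gauss_code" where
  "kinked_trefoil 0 = kink_edges 3 trefoil_shadow"
| "kinked_trefoil (Suc n) = kink (n + 9) @ kinked_trefoil n"

lemma well_formed_trefoil_shadow: "well_formed trefoil_shadow"
  by (auto simp: well_formed_def trefoil_shadow_def)

text \<open>Two triangles and three bigons; the third move uses the first triangle, with edges 0, 2
  and 4.\<close>

lemma faces_trefoil_shadow:
  "faces trefoil_shadow = set ` set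
     [[(0, True), (4, True), (2, True)], [(0, False), (2, False), (4, False)],
      [(1, True), (5, False)], [(1, False), (3, True)], [(3, False), (5, True)]]"
proof (rule faces_eq_cycles)
  note T = trefoil_shadow_def
  have m: "mate trefoil_shadow 0 = 3" "mate trefoil_shadow (Suc 0) = 4" "mate trefoil_shadow 2 = 5"
    "mate trefoil_shadow 3 = 0" "mate trefoil_shadow 4 = 1" "mate trefoil_shadow 5 = 2"
    by (rule mate_eqI[OF well_formed_trefoil_shadow]; simp add: T)+
  have l: "length trefoil_shadow = 6" by (simp add: T)
  have n: "trefoil_shadow ! 0 = Passage 0 True True" "trefoil_shadow ! Suc 0 = Passage 1 True False"
    "trefoil_shadow ! 2 = Passage 2 False False" "trefoil_shadow ! 3 = Passage 0 False True"
    "trefoil_shadow ! 4 = Passage 1 False False" "trefoil_shadow ! 5 = Passage 2 True False"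
    by (simp_all add: T)
  fix xs :: "dart list" assume "xs \<in> set [[(0, True), (4, True), (2, True)], [(0, False), (2, False), (4, False)],
      [(1, True), (5, False)], [(1, False), (3, True)], [(3, False), (5, True)]]"
  then show "map (face_next trefoil_shadow) xs = rotate1 xs"
    by (auto simp: face_next_def m l n numeral_2_eq_2[symmetric])
next
  show "\<Union> (set ` set [[(0, True), (4, True), (2, True)], [(0, False), (2, False), (4, False)],
      [(1, True), (5, False)], [(1, False), (3, True)], [(3, False), (5, True)]]) = darts trefoil_shadow"
    (is "?A = _")
  proof (rule set_eqI)
    fix d :: dart
    obtain i b where d: "d = (i, b)" by (cases d)
    have "i < 6 \<longleftrightarrow> i = 0 \<or> i = 1 \<or> i = 2 \<or> i = 3 \<or> i = 4 \<or> i = 5" by presburger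
    moreover have "d \<in> darts trefoil_shadow \<longleftrightarrow> i < 6"
      by (simp add: d darts_def trefoil_shadow_def eval_nat_numeral)
    moreover have "d \<in> ?A \<longleftrightarrow> i = 0 \<or> i = 1 \<or> i = 2 \<or> i = 3 \<or> i = 4 \<or> i = 5"
      unfolding d by (cases b; simp; blast)
    ultimately show "d \<in> ?A \<longleftrightarrow> d \<in> darts trefoil_shadow" by simp
  qed
qed simp

lemma knot_code_trefoil_shadow: "knot_code trefoil_shadow"
proof -
  have "card (faces trefoil_shadow) = 5"
    unfolding faces_trefoil_shadow by (subst card_sets_of_distinct_concat) simp_all
  then show ?thesis
    using well_formed_trefoil_shadow by (simp add: knot_code_def spherical_def trefoil_shadow_def)
qed

lemma omega1_up_kink:
  assumes "knot_code (u @ v)" "v \<noteq> []" "c \<notin> crossing ` set (u @ v)"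
    and "w = u @ v" "w' = u @ [Passage c a s, Passage c (\<not> a) s] @ v"
  shows "knot_code w'" "omega1_up\<^sup>*\<^sup>* (abs_knot_diagram w) (abs_knot_diagram w')"
proof -
  show k: "knot_code w'" using knot_code_insert_kink[OF assms(1-3)] assms(5) by simp
  have "omega1_up (abs_knot_diagram w) (abs_knot_diagram w')"
    unfolding omega1_up_def using assms k represents_abs by blast
  then show "omega1_up\<^sup>*\<^sup>* (abs_knot_diagram w) (abs_knot_diagram w')" by blast
qed

lemma omega1_up_nested_kinks:
  "knot_code nested_kinks" "omega1_up\<^sup>*\<^sup>* unknot_diagram (abs_knot_diagram nested_kinks)"
proof -
  let ?a = "[Passage 1 True False, Passage 1 False False]"
  let ?b = "[Passage 1 True False, Passage 0 True True, Passage 0 False True, Passage 1 False False]"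
  have a: "knot_code ?a" using knot_code_figure_eight[of 1 True False] by simp
  have "omega1_up unknot_diagram (abs_knot_diagram ?a)"
    unfolding omega1_up_def unknot_diagram_def
    by (rule exI[of _ "[]"], rule exI[of _ "[]"], rule exI[of _ 1], rule exI[of _ True], rule exI[of _ False])
      (use a knot_code_Nil in \<open>simp add: represents_abs\<close>)
  moreover note b = omega1_up_kink[of "[Passage 1 True False]" "[Passage 1 False False]" 0 ?a ?b True True]
  moreover note omega1_up_kink[of "[Passage 1 True False, Passage 0 True True, Passage 0 False True]"
      "[Passage 1 False False]" 2 ?b nested_kinks False False]
  ultimately show "knot_code nested_kinks"
    "omega1_up\<^sup>*\<^sup>* unknot_diagram (abs_knot_diagram nested_kinks)"
    using a by (simp_all add: nested_kinks_def)
qed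

lemma omega3I:
  assumes "represents (p @ [a, a'] @ q @ [b, b'] @ r @ [c, c'] @ t) D"
    "represents (p @ [a', a] @ q @ [b', b] @ r @ [c', c] @ t) D'"
    "bounds_triangle (p @ [a, a'] @ q @ [b, b'] @ r @ [c, c'] @ t)
       {length p, length p + 2 + length q, length p + 2 + length q + 2 + length r}"
    "card (crossing ` {a, a', b, b', c, c'}) = 3"
    "\<exists>(x, y) \<in> {(a, a'), (b, b'), (c, c')}. over x \<and> over y"
    "\<exists>(x, y) \<in> {(a, a'), (b, b'), (c, c')}. \<not> over x \<and> \<not> over y"
  shows "omega3 D D'"
  unfolding omega3_def Let_def using assms by (intro exI conjI)

lemma omega3_trefoil_shadow:
  "omega3 (abs_knot_diagram trefoil_shadow) (abs_knot_diagram nested_kinks)"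
proof -
  have "edge_of trefoil_shadow ` {(0, True), (4, True), (2, True)} = {0, 2, 4}" by auto
  moreover have "{(0, True), (4, True), (2, True)} \<in> faces trefoil_shadow"
    unfolding faces_trefoil_shadow by simp
  ultimately have "bounds_triangle trefoil_shadow {0, 2, 4}"
    unfolding bounds_triangle_def by (intro conjI bexI) auto
  moreover have "represents trefoil_shadow (abs_knot_diagram trefoil_shadow)"
    "represents nested_kinks (abs_knot_diagram nested_kinks)"
    using knot_code_trefoil_shadow omega1_up_nested_kinks represents_abs by blast+
  ultimately show ?thesis
    using omega3I[of "[]" "Passage 0 True True" "Passage 1 True False" "[]" "Passage 2 False False"
        "Passage 0 False True" "[]" "Passage 1 False False" "Passage 2 True False" "[]"]
    by (simp add: trefoil_shadow_def nested_kinks_def eval_nat_numeral card_insert_if)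
qed

text \<open>The finished part of the code moves into \<open>u\<close>, and \<open>m\<close> bounds
  the names used so far, so \<open>m\<close> itself is fresh for the next kink.\<close>

lemma omega1_up_kink_edges:
  assumes "knot_code (u @ v)" "crossing ` set (u @ v) \<subseteq> {..<m}"
  shows "knot_code (u @ kink_edges m v) \<and>
    omega1_up\<^sup>*\<^sup>* (abs_knot_diagram (u @ v)) (abs_knot_diagram (u @ kink_edges m v))"
  using assms
proof (induction v arbitrary: u m)
  case (Cons p v)
  have "m \<notin> crossing ` set (u @ p # v)" using Cons.prems(2) by auto
  note up = omega1_up_kink[OF Cons.prems(1) _ this refl refl, where a = True and s = True]
  have "knot_code ((u @ kink m @ [p]) @ v)" using up(1) by simp
  moreover have "crossing ` set ((u @ kink m @ [p]) @ v) \<subseteq> {..<Suc m}"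
    using Cons.prems(2) by auto
  ultimately show ?case using Cons.IH[of "u @ kink m @ [p]" "Suc m"] up(2) by auto
qed simp

lemma crossing_kinked_trefoil: "crossing ` set (kinked_trefoil n) \<subseteq> {..<n + 9}"
  by (induction n) (auto simp: trefoil_shadow_def)

lemma length_kinked_trefoil: "length (kinked_trefoil n) = 2 * n + 18"
  by (induction n) (simp_all add: trefoil_shadow_def)

lemma omega1_up_kinked_trefoil:
  "knot_code (kinked_trefoil n) \<and>
    omega1_up\<^sup>*\<^sup>* (abs_knot_diagram trefoil_shadow) (abs_knot_diagram (kinked_trefoil n))"
proof (induction n)
  case 0
  have "crossing ` set ([] @ trefoil_shadow) \<subseteq> {..<3}" by (simp add: trefoil_shadow_def)
  from omega1_up_kink_edges[OF _ this] show ?case using knot_code_trefoil_shadow by simp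
next
  case (Suc n)
  have fresh: "n + 9 \<notin> crossing ` set ([] @ kinked_trefoil n)" using crossing_kinked_trefoil by force
  have "kinked_trefoil n \<noteq> []" using length_kinked_trefoil[of n] by auto
  note up = omega1_up_kink[OF _ this fresh refl refl, where a = True and s = True]
  show ?case using Suc up by auto
qed

lemma fortified_kinked_trefoil: "fortified (kinked_trefoil n)"
proof (induction n)
  case 0
  \<comment> \<open>Crossings 0, 1, 2 are the core; each kink, 3 to 8, lends its name to the edge on
    which it sits.\<close>
  let ?h = "\<lambda>c :: nat. if c < 3 then None else Some c"
  have "padded (map (label ?h) (kinked_trefoil 0))"
    by (auto simp: padded_def adjacent_def cyclic_pairs_def label_def trefoil_shadow_def)
  moreover have "interlaced (kinked_trefoil 0) 0 1"
    by (simp add: interlaced_def trefoil_shadow_def)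
  ultimately show ?case
    unfolding fortified_def by (intro exI[of _ ?h] exI[of _ 0] exI[of _ 1] conjI) simp_all
next
  case (Suc n)
  have "n + 9 \<notin> crossing ` set (kinked_trefoil n)" using crossing_kinked_trefoil by force
  then show ?case
    using fortified_kink[of "[]" "kinked_trefoil n" "Passage (n + 9) True True"] Suc by simp
qed

lemma RI_III_imp_same_knot:
  assumes "RI_III_related D D'"
  shows "same_knot D D'"
  using assms unfolding RI_III_related_def same_knot_def
  by (rule rtranclp_mono[THEN predicate2D, rotated]) auto

theorem theorem3p4:
  shows "infinite {{D, D'} | D D'.
           trivial_knot_diagram D \<and> trivial_knot_diagram D' \<and> RI_III_related D D' \<and>
           \<not> sorted_transformable D D' \<and> \<not> sorted_transformable D' D}"
  (is "infinite ?S")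
proof -
  define K where "K n = abs_knot_diagram (kinked_trefoil n)" for n
  let ?R = "sup omega1_up (sup omega1_down omega3)"
  have down: "?R\<^sup>*\<^sup>* E F" if "omega1_up\<^sup>*\<^sup>* F E" for E F
  proof -
    have "omega1_down\<^sup>*\<^sup>* E F" using that by (simp add: rtranclp_conversep)
    then show ?thesis by (rule rtranclp_mono[THEN predicate2D, rotated]) auto
  qed
  \<comment> \<open>The third move comes between two runs of removals: the kinks on the edges have
    to go before the triangle is free.\<close>
  have rel: "RI_III_related (K n) unknot_diagram" for n
  proof -
    have "?R\<^sup>*\<^sup>* (K n) (abs_knot_diagram trefoil_shadow)"
      unfolding K_def using omega1_up_kinked_trefoil by (intro down) blast
    moreover have "?R (abs_knot_diagram trefoil_shadow) (abs_knot_diagram nested_kinks)"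
      using omega3_trefoil_shadow by simp
    moreover have "?R\<^sup>*\<^sup>* (abs_knot_diagram nested_kinks) unknot_diagram"
      using omega1_up_nested_kinks(2) by (rule down)
    ultimately show ?thesis
      unfolding RI_III_related_def by (rule rtranclp_trans[OF rtranclp.rtrancl_into_rtrancl])
  qed
  have rep: "represents (kinked_trefoil n) (K n)" for n
    using omega1_up_kinked_trefoil represents_abs by (simp add: K_def)
  have fort: "fortified_diagram (K n)" for n
    using fortified_diagram_iff[OF rep] fortified_kinked_trefoil by blast
  have unsorted: "\<not> sorted_transformable (K n) unknot_diagram" "\<not> sorted_transformable unknot_diagram (K n)" for n
    using fortified_not_sorted_transformable[OF fort not_interlaced_unknot_diagram] by blast+
  have "{K n, unknot_diagram} \<in> ?S" for n
  proof -
    have "trivial_knot_diagram (K n)" "trivial_knot_diagram unknot_diagram"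
      using RI_III_imp_same_knot[OF rel] by (simp_all add: trivial_knot_diagram_def same_knot_def)
    then show ?thesis using rel unsorted by blast
  qed
  then have "range (\<lambda>n. {K n, unknot_diagram}) \<subseteq> ?S" by blast
  \<comment> \<open>Isotopic codes have equal length, so the number of crossings tells the
    \<open>K n\<close> apart; none of them is the circle, so the unordered pair determines
    \<open>K n\<close>.\<close>
  moreover have "inj (\<lambda>n. {K n, unknot_diagram})"
  proof (rule injI)
    fix m n assume "{K m, unknot_diagram} = {K n, unknot_diagram}"
    moreover have "K m \<noteq> unknot_diagram"
      using fort not_interlaced_unknot_diagram fortified_imp_interlaced_diagram by metis
    ultimately have "K m = K n" by (auto simp: doubleton_eq_iff)
    then have "isotopic (kinked_trefoil m) (kinked_trefoil n)"
      using rep represents_isotopic by metis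
    then have "length (kinked_trefoil m) = length (kinked_trefoil n)"
      unfolding isotopic_def by auto
    then show "m = n" by (simp add: length_kinked_trefoil)
  qed
  ultimately show ?thesis
    using finite_subset finite_imageD infinite_UNIV_nat by blast
qed

end
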